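(* Let $Q$ be a smooth $d$-dimensional manifold and let $L:TQ\to\mathbb{R}$ be a smooth Lagrangian whose velocity Hessian $W_{ij}(q,v)=\frac{\partial^2L}{\partial v^i\partial v^j}(q,v)$ is singular with $\mathrm{rank}(W)=d-N$ on all of $TQ$. Let $H:T^*Q\to\mathbb{R}$ and the final list of (first class) constraints $\phi_1,\dots,\phi_k:T^*Q\to\mathbb{R}$ be those produced from $L$ by the Dirac–Bergmann algorithm (described in the context), and suppose that some multipliers are left undetermined, so that $k>0$ and the system has gauge degrees of freedom. Since the remaining multipliers are arbitrary, view the total (Dirac's extended) Hamiltonian as a family of functions on $T^*Q$ parameterized by $\lambda=(\lambda^1,\dots,\lambda^k)\in\mathbb{R}^k$, $$H_T:T^*Q\times\mathbb{R}^k\to\mathbb{R},\qquad H_T(x,\lambda)=H(x)+\sum_{i=1}^k\lambda^i\phi_i(x).$$ Its critical set is, in local coordinates, $\Sigma_{H_T}=\{(x,\lambda)\in\mathbb{R}^{2d}\times\mathbb{R}^k\mid\phi_i(x)=0,\ i=1,\dots,k\}$. Suppose that $0\in\mathbb{R}^k$ is a regular value of $(\phi_1,\dots,\phi_k)$, i.e. at every $x\in T^*Q$ with $\phi_1(x)=\dots=\phi_k(x)=0$ the matrix with rows $\frac{\partial\phi_1}{\partial x}(x),\dots,\frac{\partial\phi_k}{\partial x}(x)$ has rank $k$. Then $H_T$ is a Morse family on $T^*Q$ (linear in the parameters $\lambda$), and the Lagrangian submanifold of $T^*T^*Q$ (with its canonical symplectic form) that it generates is, in canonical coordinates $(x,e)\in\mathbb{R}^{2d}\times\mathbb{R}^{2d}$,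 $$\mathcal{L}_{H_T}=\Big\{(x,e)\ \Big|\ \exists\,\lambda\in\mathbb{R}^k:\ e=\frac{\partial H}{\partial x}(x)+\sum_{i=1}^k\lambda^i\frac{\partial\phi_i}{\partial x}(x),\ \ \frac{\partial H_T}{\partial\lambda^i}=\phi_i(x)=0,\ i=1,\dots,k\Big\}.$$
   Context: **Dirac–Bergmann algorithm.** Let $(q,v)$ be coordinates on $TQ$ and $x=(q,p)$ coordinates on $T^*Q$. The partial Legendre transform $l:TQ\to T^*Q$ is $l(q,v)=(q,\hat p(q,v))$ with $\hat p=\partial_vL$. The Hamiltonian $H_c:T^*Q\to\mathbb{R}$ is a function with $H_c\circ l=E$, where $E(q,v)=\hat p_a(q,v)v^a-L(q,v)$. Since $\mathrm{rank}(W)=d-N$, there are $N$ functions $\phi_j:T^*Q\to\mathbb{R}$ (primary constraints) whose common zero level set is the image $l(TQ)$. The Hamiltonian is uniquely defined only on $l(TQ)$, so one works with $H'=H_c+\sum_j\lambda^j\phi_j$ with arbitrary multipliers $\lambda^j$. With $\{\cdot,\cdot\}$ the Poisson bracket of the canonical symplectic form on $T^*Q$, one requires that the constraints be preserved along trajectories: $0=\{\phi_j,H_c\}+\sum_m\lambda^m\{\phi_j,\phi_m\}$ for every $j$. Each such condition is either identically satisfied, or yields a new (secondary) constraint if the second term vanishes, or is used to determine the respective $\lambda^j$. If secondary constraints arise, the condition is checked again for the enlarged list of constraints, and this is iterated until no new constraints arise. The total Hamiltonian is obtained by adding the final list of constraints to the Hamiltonian and substituting the expressions for the multipliers that could be determined;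 it has the form $H+\sum_{i=1}^k\lambda^i\phi_i$ with $\phi_i(x)=0$, $i=1,\dots,k$, where $H$ contains all the terms of $H'$ for which the respective $\lambda^j$ could be determined, and $\phi_1,\dots,\phi_k$ are the constraints of the final list, which are so-called first class constraints. If some multipliers are not determined, the system is said to have gauge degrees of freedom. **Morse families.** Let $\mathcal{X}$ be a smooth $n$-dimensional manifold (here $\mathcal{X}=T^*Q$, $n=2d$), with local coordinates $x=(x^1,\dots,x^n)$ inducing canonical coordinates $(x,e)$ on $T^*\mathcal{X}$, in which the canonical symplectic form is $\omega=\sum_i\mathrm{d}e_i\wedge\mathrm{d}x^i$. For a smooth function $K:\mathcal{X}\times\mathbb{R}^k\to\mathbb{R}$, $k>0$, regarded as a family of functions on $\mathcal{X}$ with parameters $\lambda\in\mathbb{R}^k$, the critical set is $$\Sigma_K=\Big\{(x,\lambda)\ \Big|\ \frac{\partial K}{\partial\lambda^i}(x,\lambda)=0,\ i=1,\dots,k\Big\}.$$ $K$ is called a Morse family on $\mathcal{X}$ if the $k\times(n+k)$ matrix $$\begin{pmatrix}\frac{\partial^2K}{\partial\lambda^i\partial x^j}(x,\lambda)&\frac{\partial^2K}{\partial\lambda^i\partial\lambda^j}(x,\lambda)\end{pmatrix}$$ has rank $k$ at every $(x,\lambda)\in\Sigma_K$. The Lagrangian submanifold generated by a Morse family $K$ is given in canonical coordinates by $$\mathcal{L}_K=\Big\{(x,e)\ \Big|\ \exists\,\lambda\in\mathbb{R}^k:\ (x,\lambda)\in\Sigma_K,\ e=\frac{\partial K}{\partial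 x}(x,\lambda)\Big\}.$$ *)

theory Defs
  imports "HOL-Analysis.Analysis"
begin

section \<open>Partial derivatives and smooth maps\<close>

definition partial :: "'n \<Rightarrow> (real ^ 'n::finite \<Rightarrow> real) \<Rightarrow> real ^ 'n \<Rightarrow> real" where
  "partial i f x = frechet_derivative f (at x) (axis i 1)"

definition gradient :: "(real ^ 'n::finite \<Rightarrow> real) \<Rightarrow> real ^ 'n \<Rightarrow> real ^ 'n" where
  "gradient f x = (\<chi> i. partial i f x)"

text \<open>Used for open sets \<open>S\<close> only, so the values of \<open>f\<close> outside \<open>S\<close> do not matter.\<close>

primrec Ck_on :: "nat \<Rightarrow> ('a::real_normed_vector \<Rightarrow> 'b::real_normed_vector) \<Rightarrow> 'a set \<Rightarrow> bool" where
  "Ck_on 0 = (\<lambda>f S. continuous_on S f)"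
| "Ck_on (Suc n) = (\<lambda>f S. (\<forall>x\<in>S. f differentiable (at x)) \<and>
     (\<forall>v. Ck_on n (\<lambda>x. frechet_derivative f (at x) v) S))"

definition smooth_on :: "'a::real_normed_vector set \<Rightarrow> ('a \<Rightarrow> 'b::real_normed_vector) \<Rightarrow> bool" where
  "smooth_on S f \<longleftrightarrow> (\<forall>n. Ck_on n f S)"

section \<open>Smooth manifolds\<close>

text \<open>A manifold is given by an atlas. A chart is its domain together with its coordinate map;
  the coordinate map is meaningful on the domain only.\<close>

type_synonym ('a, 'n) chart = "'a set \<times> ('a \<Rightarrow> (real, 'n) vec)"

abbreviation chart_image :: "('a, 'n::finite) chart \<Rightarrow> (real ^ 'n) set" where
  "chart_image c \<equiv> snd c ` fst c"

abbreviation chart_inv :: "('a, 'n::finite) chart \<Rightarrow> real ^ 'n \<Rightarrow> 'a" where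
  "chart_inv c \<equiv> inv_into (fst c) (snd c)"

definition points :: "('a, 'n::finite) chart set \<Rightarrow> 'a set" where
  "points A = \<Union> (fst ` A)"

definition charts_at :: "('a, 'n::finite) chart set \<Rightarrow> 'a \<Rightarrow> ('a, 'n) chart set" where
  "charts_at A q = {c \<in> A. q \<in> fst c}"

definition transition :: "('a, 'n::finite) chart \<Rightarrow> ('a, 'n) chart \<Rightarrow> real ^ 'n \<Rightarrow> real ^ 'n" where
  "transition c c' = snd c' \<circ> chart_inv c"

definition manifold_topology :: "('a, 'n::finite) chart set \<Rightarrow> 'a topology" where
  "manifold_topology A = topology_generated_by {{q \<in> fst c. snd c q \<in> W} | c W. c \<in> A \<and> open W}"

definition smooth_manifold :: "('a, 'n::finite) chart set \<Rightarrow> bool" where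
  "smooth_manifold A \<longleftrightarrow>
     (\<forall>c\<in>A. inj_on (snd c) (fst c) \<and> open (chart_image c)) \<and>
     (\<forall>c\<in>A. \<forall>c'\<in>A. open (snd c ` (fst c \<inter> fst c')) \<and>
        smooth_on (snd c ` (fst c \<inter> fst c')) (transition c c')) \<and>
     Hausdorff_space (manifold_topology A) \<and> second_countable (manifold_topology A)"

definition smooth_function :: "('a, 'n::finite) chart set \<Rightarrow> ('a \<Rightarrow> real) \<Rightarrow> bool" where
  "smooth_function A f \<longleftrightarrow> (\<forall>c\<in>A. smooth_on (chart_image c) (f \<circ> chart_inv c))"

section \<open>Tangent and cotangent bundles\<close>

text \<open>A (co)tangent vector at \<open>q\<close> is the family of its components in the charts around \<open>q\<close>,
  subject to the usual transformation law; to make the family unique it is \<open>0\<close> at all other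
  charts.\<close>

type_synonym ('a, 'n) bundle_point = "'a \<times> (('a, 'n) chart \<Rightarrow> (real, 'n) vec)"

definition tangent_space ::
    "('a, 'n::finite) chart set \<Rightarrow> 'a \<Rightarrow> (('a, 'n) chart \<Rightarrow> real ^ 'n) set" where
  "tangent_space A q = {v. (\<forall>c. c \<notin> charts_at A q \<longrightarrow> v c = 0) \<and>
     (\<forall>c\<in>charts_at A q. \<forall>c'\<in>charts_at A q.
        v c' = frechet_derivative (transition c c') (at (snd c q)) (v c))}"

definition cotangent_space ::
    "('a, 'n::finite) chart set \<Rightarrow> 'a \<Rightarrow> (('a, 'n) chart \<Rightarrow> real ^ 'n) set" where
  "cotangent_space A q = {p. (\<forall>c. c \<notin> charts_at A q \<longrightarrow> p c = 0) \<and>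
     (\<forall>c\<in>charts_at A q. \<forall>c'\<in>charts_at A q. \<forall>w.
        p c \<bullet> w = p c' \<bullet> frechet_derivative (transition c c') (at (snd c q)) w)}"

text \<open>Coordinates on a bundle are indexed by the sum type \<open>'n + 'n\<close>: \<open>Inl i\<close> is the \<open>i\<close>-th base
  coordinate and \<open>Inr i\<close> the \<open>i\<close>-th fibre coordinate.\<close>

definition join :: "real ^ 'n::finite \<Rightarrow> real ^ 'n \<Rightarrow> real ^ ('n + 'n)" where
  "join x y = (\<chi> s. case s of Inl i \<Rightarrow> x $ i | Inr i \<Rightarrow> y $ i)"

definition tangent_chart ::
    "('a, 'n::finite) chart set \<Rightarrow> ('a, 'n) chart \<Rightarrow> (('a, 'n) bundle_point, 'n + 'n) chart" where
  "tangent_chart A c =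
     ({(q, v). q \<in> fst c \<and> v \<in> tangent_space A q}, \<lambda>(q, v). join (snd c q) (v c))"

definition cotangent_chart ::
    "('a, 'n::finite) chart set \<Rightarrow> ('a, 'n) chart \<Rightarrow> (('a, 'n) bundle_point, 'n + 'n) chart" where
  "cotangent_chart A c =
     ({(q, p). q \<in> fst c \<and> p \<in> cotangent_space A q}, \<lambda>(q, p). join (snd c q) (p c))"

definition tangent_bundle ::
    "('a, 'n::finite) chart set \<Rightarrow> (('a, 'n) bundle_point, 'n + 'n) chart set" where
  "tangent_bundle A = tangent_chart A ` A"

definition cotangent_bundle ::
    "('a, 'n::finite) chart set \<Rightarrow> (('a, 'n) bundle_point, 'n + 'n) chart set" where
  "cotangent_bundle A = cotangent_chart A ` A"

text \<open>The canonical symplectic form \<open>\<Sum>\<^sub>i de\<^sub>i \<and> dx\<^sup>i\<close> of a cotangent bundle, in canonical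
  coordinates.\<close>

definition canonical_form :: "real ^ ('n::finite + 'n) \<Rightarrow> real ^ ('n + 'n) \<Rightarrow> real" where
  "canonical_form u w = (\<Sum>i\<in>UNIV. u $ Inr i * w $ Inl i - u $ Inl i * w $ Inr i)"

text \<open>In canonical coordinates the set is locally the zero set of a submersion from an open
  subset of the \<open>2n\<close>-dimensional coordinate space to the \<open>n\<close>-dimensional one. Its tangent space is
  then the kernel of the derivative, of dimension \<open>n\<close>, on which the symplectic form has to
  vanish.\<close>

definition lagrangian_submanifold ::
    "('a, 'n::finite) chart set \<Rightarrow> ('a, 'n) bundle_point set \<Rightarrow> bool" where
  "lagrangian_submanifold A S \<longleftrightarrow> S \<subseteq> points (cotangent_bundle A) \<and>
     (\<forall>\<xi>\<in>S. \<forall>C\<in>charts_at (cotangent_bundle A) \<xi>.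
        \<exists>V (F :: real ^ ('n + 'n) \<Rightarrow> real ^ 'n).
          open V \<and> V \<subseteq> chart_image C \<and> snd C \<xi> \<in> V \<and> smooth_on V F \<and>
          {z \<in> V. F z = 0} = snd C ` (S \<inter> fst C) \<inter> V \<and>
          (\<forall>z\<in>V. F z = 0 \<longrightarrow> surj (frechet_derivative F (at z)) \<and>
             (\<forall>u w. frechet_derivative F (at z) u = 0 \<longrightarrow> frechet_derivative F (at z) w = 0 \<longrightarrow>
                canonical_form u w = 0)))"

section \<open>Morse families\<close>

definition critical_set ::
    "('x, 'n::finite) chart set \<Rightarrow> ('x \<times> (real ^ 'k::finite) \<Rightarrow> real) \<Rightarrow> ('x \<times> (real ^ 'k)) set" where
  "critical_set A K = {(x, l). x \<in> points A \<and> (\<forall>i. partial i (\<lambda>m. K (x, m)) l = 0)}"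

definition morse_matrix ::
    "('x, 'n::finite) chart \<Rightarrow> ('x \<times> (real ^ 'k::finite) \<Rightarrow> real) \<Rightarrow> 'x \<Rightarrow> real ^ 'k
      \<Rightarrow> real ^ ('n + 'k) ^ 'k" where
  "morse_matrix c K x l = (\<chi> i s. case s of
     Inl j \<Rightarrow> partial i (\<lambda>m. partial j (\<lambda>y. K (chart_inv c y, m)) (snd c x)) l
   | Inr j \<Rightarrow> partial i (partial j (\<lambda>m. K (x, m))) l)"

definition morse_family ::
    "('x, 'n::finite) chart set \<Rightarrow> ('x \<times> (real ^ 'k::finite) \<Rightarrow> real) \<Rightarrow> bool" where
  "morse_family A K \<longleftrightarrow>
     (\<forall>c\<in>A. smooth_on (chart_image c \<times> UNIV) (\<lambda>(y, l). K (chart_inv c y, l))) \<and>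
     (\<forall>(x, l)\<in>critical_set A K. \<forall>c\<in>charts_at A x. rank (morse_matrix c K x l) = CARD('k))"

definition generated_submanifold ::
    "('x, 'n::finite) chart set \<Rightarrow> ('x \<times> (real ^ 'k::finite) \<Rightarrow> real) \<Rightarrow> ('x, 'n) bundle_point set" where
  "generated_submanifold A K = {(x, e). e \<in> cotangent_space A x \<and> (\<exists>l. (x, l) \<in> critical_set A K \<and>
     (\<forall>c\<in>charts_at A x. e c = gradient (\<lambda>y. K (chart_inv c y, l)) (snd c x)))}"

section \<open>Singular Lagrangians\<close>

definition velocity_hessian ::
    "('q, 'd::finite) chart set \<Rightarrow> (('q, 'd) bundle_point \<Rightarrow> real) \<Rightarrow> ('q, 'd) chart
      \<Rightarrow> ('q, 'd) bundle_point \<Rightarrow> real ^ 'd ^ 'd" where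
  "velocity_hessian Q L c z = (let C = tangent_chart Q c in
     \<chi> i j. partial (Inr i) (partial (Inr j) (L \<circ> chart_inv C)) (snd C z))"

definition legendre ::
    "('q, 'd::finite) chart set \<Rightarrow> (('q, 'd) bundle_point \<Rightarrow> real)
      \<Rightarrow> ('q, 'd) bundle_point \<Rightarrow> ('q, 'd) bundle_point" where
  "legendre Q L = (\<lambda>(q, v). (q, \<lambda>c. if c \<in> charts_at Q q
     then let C = tangent_chart Q c in \<chi> i. partial (Inr i) (L \<circ> chart_inv C) (snd C (q, v))
     else 0))"

text \<open>The pairing of a covector with a vector and the canonical Poisson bracket do not depend on
  the chart in which they are computed; an arbitrary one is chosen.\<close>

definition energy ::
    "('q, 'd::finite) chart set \<Rightarrow> (('q, 'd) bundle_point \<Rightarrow> real)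
      \<Rightarrow> ('q, 'd) bundle_point \<Rightarrow> real" where
  "energy Q L = (\<lambda>(q, v). let c = (SOME c. c \<in> charts_at Q q) in
     snd (legendre Q L (q, v)) c \<bullet> v c - L (q, v))"

definition poisson ::
    "('q, 'd::finite) chart set \<Rightarrow> (('q, 'd) bundle_point \<Rightarrow> real) \<Rightarrow> (('q, 'd) bundle_point \<Rightarrow> real)
      \<Rightarrow> ('q, 'd) bundle_point \<Rightarrow> real" where
  "poisson Q f g x = (let C = (SOME C. C \<in> charts_at (cotangent_bundle Q) x);
       F = f \<circ> chart_inv C; G = g \<circ> chart_inv C; z = snd C x in
     \<Sum>i\<in>UNIV. partial (Inl i) F z * partial (Inr i) G z - partial (Inr i) F z * partial (Inl i) G z)"

section \<open>The Dirac--Bergmann algorithm\<close>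

definition zero_set :: "('q, 'd::finite) chart set \<Rightarrow> (('q, 'd) bundle_point \<Rightarrow> real) list
    \<Rightarrow> ('q, 'd) bundle_point set" where
  "zero_set Q \<Phi> = {x \<in> points (cotangent_bundle Q). \<forall>\<phi>\<in>set \<Phi>. \<phi> x = 0}"

definition smooth_combination :: "('q, 'd::finite) chart set \<Rightarrow> (('q, 'd) bundle_point \<Rightarrow> real) list
    \<Rightarrow> (('q, 'd) bundle_point \<Rightarrow> real) \<Rightarrow> bool" where
  "smooth_combination Q \<Phi> f \<longleftrightarrow> smooth_function (cotangent_bundle Q) f \<and>
     (\<exists>a. (\<forall>j < length \<Phi>. smooth_function (cotangent_bundle Q) (a j)) \<and>
       (\<forall>x\<in>points (cotangent_bundle Q). f x = (\<Sum>j < length \<Phi>. a j x * (\<Phi> ! j) x)))"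

definition equivalent_constraints :: "('q, 'd::finite) chart set \<Rightarrow> (('q, 'd) bundle_point \<Rightarrow> real) list
    \<Rightarrow> (('q, 'd) bundle_point \<Rightarrow> real) list \<Rightarrow> bool" where
  "equivalent_constraints Q \<Phi> \<Psi> \<longleftrightarrow> length \<Phi> = length \<Psi> \<and>
     (\<forall>\<psi>\<in>set \<Psi>. smooth_combination Q \<Phi> \<psi>) \<and> (\<forall>\<phi>\<in>set \<Phi>. smooth_combination Q \<Psi> \<phi>)"

text \<open>
  A stage \<open>H, \<Theta>, \<rho>\<close> of the algorithm stands for the Hamiltonian \<open>H + \<Sum>\<^sub>m \<lambda>\<^sup>m \<Theta>\<^sub>m\<close> in which the
  multipliers \<open>\<lambda>\<^sup>m\<close> are still undetermined; \<open>\<Theta> @ \<rho>\<close> is the current list of constraints, where \<open>\<rho>\<close>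
  consists of the secondary constraints and of the primary ones whose multiplier has been
  determined and substituted. The consistency condition of a constraint \<open>\<psi>\<close> is
  \<open>0 = {\<psi>, H} + \<Sum>\<^sub>m \<lambda>\<^sup>m {\<psi>, \<Theta>\<^sub>m}\<close> on the common zero set of the constraints.

  In \<open>determine\<close> this condition is solved there for the multiplier of \<open>\<theta>\<close>,
  \<open>\<lambda> = u + \<Sum>\<^sub>m b\<^sub>m \<lambda>\<^sup>m\<close>, and \<open>\<lambda>\<close> is substituted in the Hamiltonian. This does not change the
  other conditions, because the terms \<open>{\<psi>, u} \<theta>\<close> and \<open>{\<psi>, b\<^sub>m} \<theta>\<close> vanish on the zero set.

  By \<open>recombine\<close> the constraints are known only up to an invertible change of generators, as is
  needed to separate the first class constraints from the others; the generators \<open>\<Theta>\<close> are only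
  changed among themselves, which is a change of the undetermined multipliers.
\<close>

inductive dirac_stage ::
    "('q, 'd::finite) chart set \<Rightarrow> (('q, 'd) bundle_point \<Rightarrow> real) \<Rightarrow> nat
      \<Rightarrow> (('q, 'd) bundle_point \<Rightarrow> real) \<Rightarrow> (('q, 'd) bundle_point \<Rightarrow> real) list
      \<Rightarrow> (('q, 'd) bundle_point \<Rightarrow> real) list \<Rightarrow> bool"
  for Q L N where
  primary:
    "\<lbrakk>smooth_function (cotangent_bundle Q) Hc;
      \<forall>z\<in>points (tangent_bundle Q). Hc (legendre Q L z) = energy Q L z;
      length \<Phi> = N; \<forall>\<phi>\<in>set \<Phi>. smooth_function (cotangent_bundle Q) \<phi>;
      zero_set Q \<Phi> = legendre Q L ` points (tangent_bundle Q)\<rbrakk>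
     \<Longrightarrow> dirac_stage Q L N Hc \<Phi> []"
| secondary:
    "\<lbrakk>dirac_stage Q L N H \<Theta> \<rho>; \<psi> \<in> set (\<Theta> @ \<rho>);
      \<forall>\<theta>\<in>set \<Theta>. \<forall>x\<in>zero_set Q (\<Theta> @ \<rho>). poisson Q \<psi> \<theta> x = 0;
      smooth_function (cotangent_bundle Q) f;
      \<forall>x\<in>points (cotangent_bundle Q). f x = poisson Q \<psi> H x;
      \<exists>x\<in>zero_set Q (\<Theta> @ \<rho>). f x \<noteq> 0\<rbrakk>
     \<Longrightarrow> dirac_stage Q L N H \<Theta> (\<rho> @ [f])"
| determine:
    "\<lbrakk>dirac_stage Q L N H (\<Theta>\<^sub>1 @ \<theta> # \<Theta>\<^sub>2) \<rho>; \<psi> \<in> set ((\<Theta>\<^sub>1 @ \<theta> # \<Theta>\<^sub>2) @ \<rho>);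
      \<forall>x\<in>zero_set Q ((\<Theta>\<^sub>1 @ \<theta> # \<Theta>\<^sub>2) @ \<rho>). poisson Q \<psi> \<theta> x \<noteq> 0;
      smooth_function (cotangent_bundle Q) u;
      length b = length (\<Theta>\<^sub>1 @ \<Theta>\<^sub>2); \<forall>\<beta>\<in>set b. smooth_function (cotangent_bundle Q) \<beta>;
      \<forall>x\<in>zero_set Q ((\<Theta>\<^sub>1 @ \<theta> # \<Theta>\<^sub>2) @ \<rho>).
        poisson Q \<psi> H x + u x * poisson Q \<psi> \<theta> x = 0 \<and>
        (\<forall>m < length b. poisson Q \<psi> ((\<Theta>\<^sub>1 @ \<Theta>\<^sub>2) ! m) x + (b ! m) x * poisson Q \<psi> \<theta> x = 0)\<rbrakk>
     \<Longrightarrow> dirac_stage Q L N (\<lambda>x. H x + u x * \<theta> x)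
           (map2 (\<lambda>\<eta> \<beta> x. \<eta> x + \<beta> x * \<theta> x) (\<Theta>\<^sub>1 @ \<Theta>\<^sub>2) b) (\<theta> # \<rho>)"
| recombine:
    "\<lbrakk>dirac_stage Q L N H \<Theta> \<rho>; equivalent_constraints Q \<Theta> \<Theta>';
      equivalent_constraints Q (\<Theta> @ \<rho>) (\<Theta>' @ \<rho>')\<rbrakk>
     \<Longrightarrow> dirac_stage Q L N H \<Theta>' \<rho>'"

definition first_class :: "('q, 'd::finite) chart set \<Rightarrow> (('q, 'd) bundle_point \<Rightarrow> real) list
    \<Rightarrow> (('q, 'd) bundle_point \<Rightarrow> real) \<Rightarrow> bool" where
  "first_class Q \<Phi> f \<longleftrightarrow> (\<forall>\<psi>\<in>set \<Phi>. \<forall>x\<in>zero_set Q \<Phi>. poisson Q f \<psi> x = 0)"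

text \<open>The algorithm stops with \<open>H\<close>, with the undetermined multipliers belonging to the list \<open>\<Theta>\<close>,
  and with the first class constraints \<open>\<phi>\<^sub>i\<close>, enumerated by the finite type \<open>'k\<close>.\<close>

definition dirac_bergmann ::
    "('q, 'd::finite) chart set \<Rightarrow> (('q, 'd) bundle_point \<Rightarrow> real) \<Rightarrow> nat
      \<Rightarrow> (('q, 'd) bundle_point \<Rightarrow> real) \<Rightarrow> (('q, 'd) bundle_point \<Rightarrow> real) list
      \<Rightarrow> ('k::finite \<Rightarrow> ('q, 'd) bundle_point \<Rightarrow> real) \<Rightarrow> bool" where
  "dirac_bergmann Q L N H \<Theta> \<phi> \<longleftrightarrow> (\<exists>\<rho> ks.
     dirac_stage Q L N H \<Theta> \<rho> \<and>
     (\<forall>\<psi>\<in>set (\<Theta> @ \<rho>). \<forall>x\<in>zero_set Q (\<Theta> @ \<rho>).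
        poisson Q \<psi> H x = 0 \<and> (\<forall>\<theta>\<in>set \<Theta>. poisson Q \<psi> \<theta> x = 0)) \<and>
     distinct ks \<and> set ks = (UNIV :: 'k set) \<and>
     map \<phi> ks = filter (first_class Q (\<Theta> @ \<rho>)) (\<Theta> @ \<rho>))"

definition total_hamiltonian ::
    "('x \<Rightarrow> real) \<Rightarrow> ('k::finite \<Rightarrow> 'x \<Rightarrow> real) \<Rightarrow> 'x \<times> (real ^ 'k) \<Rightarrow> real" where
  "total_hamiltonian H \<phi> = (\<lambda>(x, l). H x + (\<Sum>i\<in>UNIV. l $ i * \<phi> i x))"

definition zero_regular_value ::
    "('x, 'n::finite) chart set \<Rightarrow> ('k::finite \<Rightarrow> 'x \<Rightarrow> real) \<Rightarrow> bool" where
  "zero_regular_value A \<phi> \<longleftrightarrow> (\<forall>x\<in>points A. (\<forall>i. \<phi> i x = 0) \<longrightarrow>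
     (\<forall>c\<in>charts_at A x.
        rank ((\<chi> i. gradient (\<phi> i \<circ> chart_inv c) (snd c x)) :: real ^ 'n ^ 'k) = CARD('k)))"

end

theory Submission
  imports Defs
begin

text \<open>The family is affine in \<open>\<lambda>\<close>, so \<open>\<partial>H\<^sub>T/\<partial>\<lambda>\<^sup>i = \<phi>\<^sub>i\<close> and the Morse matrix is \<open>(\<partial>\<phi>/\<partial>x | 0)\<close>, of rank
  \<open>k\<close> because \<open>0\<close> is a regular value. In a canonical chart the generated set consists of the
  \<open>(x, e)\<close> with \<open>\<phi>(x) = 0\<close> and \<open>e - \<nabla>H(x)\<close> in the span of the gradients \<open>\<nabla>\<phi>\<^sub>i(x)\<close>; Cramer's rule turns
  the latter into \<open>n - k\<close> smooth equations. A tangent vector \<open>(dx, de)\<close> has \<open>\<nabla>\<phi>\<^sub>i \<bullet> dx = 0\<close> and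
  \<open>de = Hess dx + \<Sum>\<^sub>i \<mu>\<^sub>i \<nabla>\<phi>\<^sub>i\<close>, where \<open>Hess\<close> is the Hessian of \<open>H\<^sub>T\<close> at fixed \<open>\<lambda>\<close>, so the symplectic
  form vanishes by symmetry of \<open>Hess\<close>.\<close>

section \<open>Calculus of smooth maps\<close>

text \<open>The generated set is described by an existential multiplier, whereas a Lagrangian
  submanifold is certified by explicit equations in \<open>(x, e)\<close>, so \<lambda> must be
  eliminated. Near a given point this is done without solving for \<lambda>: the gradients of the
  constraints there are completed by constant vectors to a basis, and the cofactors belonging to the
  constant rows test whether \<open>e - \<nabla>H(x)\<close> lies in the span of the gradients.
  These tests do not see multiples of the gradients. Hence at each zero \<nabla>H can be replaced by
  the gradient of the total Hamiltonian with the multiplier of that zero frozen. The base manifold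
  is itself a cotangent bundle, so covectors over T*Q must be transported between its charts. They
  transform by first derivatives of the transitions, and differentiability of the transitions of T*Q
  follows from the second derivatives of those of Q. The Dirac-Bergmann rules enter through an
  induction showing that every stage consists of smooth functions.\<close>

lemma has_frechet_derivative:
  "f differentiable (at x) \<Longrightarrow> (f has_derivative frechet_derivative f (at x)) (at x)"
  by (simp add: frechet_derivative_works)

lemma frechet_derivative_eqI:
  "(f has_derivative f') (at x) \<Longrightarrow> frechet_derivative f (at x) = f'"
  using frechet_derivative_at by metis

lemma frechet_derivative_cong_open:
  assumes "open S" "x \<in> S" "\<And>y. y \<in> S \<Longrightarrow> f y = g y" "f differentiable (at x)"
  shows "g differentiable (at x)" "frechet_derivative g (at x) = frechet_derivative f (at x)"
proof -
  have "(g has_derivative frechet_derivative f (at x)) (at x)"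
    using has_derivative_transform_within_open[OF has_frechet_derivative[OF assms(4)] assms(1,2)] assms(3)
    by auto
  then show "g differentiable (at x)" "frechet_derivative g (at x) = frechet_derivative f (at x)"
    by (auto simp: frechet_derivative_eqI differentiable_def)
qed

section \<open>Differentiability of finite order on open sets\<close>

lemma Ck_on_cong:
  assumes "open S" "\<And>x. x \<in> S \<Longrightarrow> f x = g x" "Ck_on n f S"
  shows "Ck_on n g S"
  using assms(2,3)
proof (induction n arbitrary: f g)
  case 0
  then show ?case by (auto cong: continuous_on_cong)
next
  case (Suc n)
  have d: "g differentiable (at x)" "frechet_derivative g (at x) = frechet_derivative f (at x)"
    if "x \<in> S" for x
    using frechet_derivative_cong_open[OF assms(1) that, of f g] Suc.prems that by auto
  have "Ck_on n (\<lambda>x. frechet_derivative g (at x) v) S" for v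
    by (rule Suc.IH[of "\<lambda>x. frechet_derivative f (at x) v"]) (use Suc.prems d in auto)
  then show ?case using d by auto
qed

text \<open>Lets an explicit derivative \<open>f'\<close> stand in for
  \<open>frechet_derivative f\<close>. The two agree only on \<open>S\<close>, and openness of
  \<open>S\<close> makes that enough for the higher derivatives.\<close>

lemma Ck_on_SucI:
  assumes "open S" "\<And>x. x \<in> S \<Longrightarrow> (f has_derivative f' x) (at x)"
    and "\<And>v. Ck_on n (\<lambda>x. f' x v) S"
  shows "Ck_on (Suc n) f S"
proof -
  have "frechet_derivative f (at x) = f' x" if "x \<in> S" for x
    using assms(2)[OF that] by (rule frechet_derivative_eqI)
  then have "Ck_on n (\<lambda>x. frechet_derivative f (at x) v) S" for v
    by (intro Ck_on_cong[OF assms(1) _ assms(3)[of v]]) auto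
  then show ?thesis using assms(2) by (auto simp: differentiable_def)
qed

lemma Ck_on_Suc_imp: "Ck_on (Suc n) f S \<Longrightarrow> Ck_on n f S"
proof (induction n arbitrary: f)
  case 0
  then show ?case
    by (auto intro!: continuous_at_imp_continuous_on differentiable_imp_continuous_within)
next
  case (Suc n)
  then show ?case by (auto simp del: Ck_on.simps(1) dest: spec)
qed

lemma Ck_on_const: "Ck_on n (\<lambda>x. c) S"
  by (induction n arbitrary: c) auto

lemma Ck_on_add:
  assumes "open S" "Ck_on n f S" "Ck_on n g S"
  shows "Ck_on n (\<lambda>x. f x + g x) S"
  using assms(2,3)
proof (induction n arbitrary: f g)
  case 0
  then show ?case by (auto intro: continuous_on_add)
next
  case (Suc n)
  show ?case
    by (rule Ck_on_SucI[OF assms(1) has_derivative_add]) (use Suc in \<open>auto intro: has_frechet_derivative\<close>)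
qed

lemma Ck_on_bilinear:
  fixes prod (infixl "\<odot>" 70)
  assumes b: "bounded_bilinear prod" and "open S" "Ck_on n f S" "Ck_on n g S"
  shows "Ck_on n (\<lambda>x. f x \<odot> g x) S"
  using assms(3,4)
proof (induction n arbitrary: f g)
  case 0
  then show ?case by (auto intro: bounded_bilinear.continuous_on[OF b])
next
  case (Suc n)
  \<comment> \<open>The product rule pairs each derivative with an undifferentiated factor, so the
    induction hypothesis is also applied to \<open>f\<close> and \<open>g\<close> themselves at
    order \<open>n\<close>.\<close>
  have fg: "Ck_on n f S" "Ck_on n g S"
    using Suc.prems Ck_on_Suc_imp by blast+
  show ?case
    by (rule Ck_on_SucI[OF assms(2) bounded_bilinear.FDERIV[OF b]])
      (use Suc fg in \<open>auto intro!: has_frechet_derivative Ck_on_add assms(2)\<close>)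
qed

text \<open>For a linear inner map, a directional derivative of the composite is a directional
  derivative of \<open>f\<close> composed with the same map, so the induction closes without a
  higher-order chain rule. The inner maps needed below are coordinate projections.\<close>

lemma Ck_on_compose_linear:
  assumes A: "bounded_linear A" and "open S" "open T" "A ` T \<subseteq> S" "Ck_on n f S"
  shows "Ck_on n (\<lambda>x. f (A x)) T"
  using assms(5)
proof (induction n arbitrary: f)
  case 0
  show ?case
    using continuous_on_compose2[of S f T A] 0 assms(4) linear_continuous_on[OF A] by auto
next
  case (Suc n)
  have "((\<lambda>x. f (A x)) has_derivative (\<lambda>v. frechet_derivative f (at (A x)) (A v))) (at x)"
    if "x \<in> T" for x
    using has_derivative_compose[OF bounded_linear_imp_has_derivative[OF A, of "at x"],
        of f "frechet_derivative f (at (A x))"] that assms(4) Suc.prems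
    by (auto intro: has_frechet_derivative)
  then show ?case
    by (rule Ck_on_SucI[OF assms(3)]) (use Suc in auto)
qed

lemma Ck_on_bounded_linear: "bounded_linear A \<Longrightarrow> open S \<Longrightarrow> Ck_on n A S"
proof (induction n)
  case 0
  then show ?case by (auto intro: linear_continuous_on)
next
  case (Suc n)
  then show ?case
    by (intro Ck_on_SucI[of _ _ "\<lambda>x. A"] bounded_linear_imp_has_derivative Ck_on_const) auto
qed

section \<open>Closure properties of smooth functions\<close>

lemma smooth_on_const: "smooth_on S (\<lambda>x. c)"
  by (simp add: smooth_on_def Ck_on_const)

lemma smooth_on_bounded_linear: "bounded_linear A \<Longrightarrow> open S \<Longrightarrow> smooth_on S A"
  by (simp add: smooth_on_def Ck_on_bounded_linear)

lemma smooth_on_compose_linear: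
  "bounded_linear A \<Longrightarrow> open S \<Longrightarrow> open T \<Longrightarrow> A ` T \<subseteq> S \<Longrightarrow> smooth_on S f \<Longrightarrow>
    smooth_on T (\<lambda>x. f (A x))"
  unfolding smooth_on_def using Ck_on_compose_linear by blast

lemma smooth_on_add:
  "open S \<Longrightarrow> smooth_on S f \<Longrightarrow> smooth_on S g \<Longrightarrow> smooth_on S (\<lambda>x. f x + g x)"
  by (simp add: smooth_on_def Ck_on_add)

lemma smooth_on_scaleR:
  "open S \<Longrightarrow> smooth_on S f \<Longrightarrow> smooth_on S g \<Longrightarrow> smooth_on S (\<lambda>x. f x *\<^sub>R g x)"
  by (simp add: smooth_on_def Ck_on_bilinear[OF bounded_bilinear_scaleR])

lemma smooth_on_mult:
  fixes f g :: "_ \<Rightarrow> real"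
  shows "open S \<Longrightarrow> smooth_on S f \<Longrightarrow> smooth_on S g \<Longrightarrow> smooth_on S (\<lambda>x. f x * g x)"
  by (simp add: smooth_on_def Ck_on_bilinear[OF bounded_bilinear_mult])

lemma smooth_on_sum:
  assumes "open S" "\<And>i. i \<in> I \<Longrightarrow> smooth_on S (f i)"
  shows "smooth_on S (\<lambda>x. \<Sum>i\<in>I. f i x)"
  using assms(2) by (induction I rule: infinite_finite_induct)
    (auto intro: smooth_on_add smooth_on_const assms(1))

lemma smooth_on_prod:
  fixes f :: "_ \<Rightarrow> _ \<Rightarrow> real"
  assumes "open S" "\<And>i. i \<in> I \<Longrightarrow> smooth_on S (f i)"
  shows "smooth_on S (\<lambda>x. \<Prod>i\<in>I. f i x)"
  using assms(2) by (induction I rule: infinite_finite_induct)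
    (auto intro: smooth_on_mult smooth_on_const assms(1))

lemma smooth_on_diff:
  fixes f g :: "_ \<Rightarrow> real"
  assumes "open S" "smooth_on S f" "smooth_on S g"
  shows "smooth_on S (\<lambda>x. f x - g x)"
  using smooth_on_add[OF assms(1,2) smooth_on_mult[OF assms(1) smooth_on_const[of _ "-1"] assms(3)]]
  by simp

lemma smooth_on_vec:
  fixes f :: "_ \<Rightarrow> real ^ 'n::finite"
  assumes "open S" "\<And>i. smooth_on S (\<lambda>x. f x $ i)"
  shows "smooth_on S f"
proof -
  have "smooth_on S (\<lambda>x. \<Sum>i\<in>UNIV. f x $ i *\<^sub>R axis i 1)"
    by (intro smooth_on_sum smooth_on_scaleR smooth_on_const assms)
  moreover have "(\<Sum>i\<in>UNIV. f x $ i *\<^sub>R axis i 1) = f x" for x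
    using basis_expansion[of "f x"] by (simp add: scalar_mult_eq_scaleR)
  ultimately show ?thesis by (metis (no_types, lifting) ext)
qed

lemma smooth_on_det:
  fixes M :: "_ \<Rightarrow> real ^ 'n::finite ^ 'n"
  assumes "open S" "\<And>i j. smooth_on S (\<lambda>x. M x $ i $ j)"
  shows "smooth_on S (\<lambda>x. det (M x))"
  unfolding det_def
  by (intro smooth_on_sum smooth_on_mult smooth_on_const smooth_on_prod assms)

lemma smooth_on_frechet_derivative:
  assumes "smooth_on S f" shows "smooth_on S (\<lambda>x. frechet_derivative f (at x) v)"
proof -
  have "Ck_on (Suc n) f S" for n using assms unfolding smooth_on_def by blast
  then show ?thesis by (simp add: smooth_on_def)
qed

lemma smooth_on_partial: "smooth_on S f \<Longrightarrow> smooth_on S (partial i f)"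
  unfolding partial_def[abs_def] by (rule smooth_on_frechet_derivative)

lemma smooth_on_differentiable: "smooth_on S f \<Longrightarrow> x \<in> S \<Longrightarrow> f differentiable (at x)"
  unfolding smooth_on_def by (metis Ck_on.simps(2))

lemma smooth_on_continuous: "smooth_on S f \<Longrightarrow> continuous_on S f"
  unfolding smooth_on_def by (metis Ck_on.simps(1))

text \<open>The mean value theorem is used twice: along \<open>u\<close> for the difference of
  \<open>f\<close> across the parallelogram, then along \<open>w\<close> for the directional
  derivative of \<open>f\<close> in direction \<open>u\<close>. The left-hand side is symmetric in
  \<open>u\<close> and \<open>w\<close>, which is what the next lemma exploits.\<close>

lemma second_derivative_mean_value:
  fixes f :: "'a::real_normed_vector \<Rightarrow> real"
  assumes f: "smooth_on S f" and h: "h > 0"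
    and S: "\<And>s t. 0 \<le> s \<Longrightarrow> s \<le> h \<Longrightarrow> 0 \<le> t \<Longrightarrow> t \<le> h \<Longrightarrow> x + s *\<^sub>R u + t *\<^sub>R w \<in> S"
  shows "\<exists>s t. 0 \<le> s \<and> s \<le> h \<and> 0 \<le> t \<and> t \<le> h \<and>
    f (x + h *\<^sub>R u + h *\<^sub>R w) - f (x + h *\<^sub>R u) - f (x + h *\<^sub>R w) + f x =
      h * h * frechet_derivative (\<lambda>y. frechet_derivative f (at y) u) (at (x + s *\<^sub>R u + t *\<^sub>R w)) w"
proof -
  have df: "(f has_derivative frechet_derivative f (at y)) (at y)" if "y \<in> S" for y
    by (rule has_frechet_derivative[OF smooth_on_differentiable[OF f that]])
  define g where "g = (\<lambda>y. frechet_derivative f (at y) u)"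
  have dg: "(g has_derivative frechet_derivative g (at y)) (at y)" if "y \<in> S" for y
    unfolding g_def
    by (rule has_frechet_derivative[OF smooth_on_differentiable[OF smooth_on_frechet_derivative[OF f] that]])
  define \<psi> where "\<psi> = (\<lambda>s. f (x + s *\<^sub>R u + h *\<^sub>R w) - f (x + s *\<^sub>R u))"
  have line: "((\<lambda>s. F (a + s *\<^sub>R v)) has_real_derivative F' v) (at s)"
    if "(F has_derivative F') (at (a + s *\<^sub>R v))" for F :: "'a \<Rightarrow> real" and F' a v s
  proof -
    have "((\<lambda>s. F (a + s *\<^sub>R v)) has_derivative (\<lambda>r. F' (r *\<^sub>R v))) (at s)"
      by (rule has_derivative_compose[where g = F and f = "\<lambda>s. a + s *\<^sub>R v", OF _ that])
        (auto intro!: derivative_eq_intros)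
    moreover have "(\<lambda>r. F' (r *\<^sub>R v)) = (*) (F' v)"
      using linear_scale[OF has_derivative_linear[OF that]] by (auto simp: mult.commute)
    ultimately show ?thesis by (simp add: has_field_derivative_def)
  qed
  have "\<exists>s. 0 < s \<and> s < h \<and> \<psi> h - \<psi> 0 = (h - 0) * (g (x + s *\<^sub>R u + h *\<^sub>R w) - g (x + s *\<^sub>R u))"
  proof (rule MVT2[OF h])
    fix s assume s: "0 \<le> s" "s \<le> h"
    have "((\<lambda>s. f (x + h *\<^sub>R w + s *\<^sub>R u)) has_real_derivative g (x + h *\<^sub>R w + s *\<^sub>R u)) (at s)"
      unfolding g_def by (rule line[OF df]) (use S[of s h] s h in \<open>simp add: algebra_simps\<close>)
    moreover have "((\<lambda>s. f (x + s *\<^sub>R u)) has_real_derivative g (x + s *\<^sub>R u)) (at s)"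
      unfolding g_def by (rule line[OF df]) (use S[of s 0] s h in \<open>simp add: algebra_simps\<close>)
    ultimately show "(\<psi> has_real_derivative (g (x + s *\<^sub>R u + h *\<^sub>R w) - g (x + s *\<^sub>R u))) (at s)"
      unfolding \<psi>_def by (auto intro!: DERIV_diff simp: add.assoc add.commute[of "h *\<^sub>R w"])
  qed
  then obtain s where s: "0 < s" "s < h"
    "\<psi> h - \<psi> 0 = h * (g (x + s *\<^sub>R u + h *\<^sub>R w) - g (x + s *\<^sub>R u))" by auto
  have "\<exists>t. 0 < t \<and> t < h \<and> g (x + s *\<^sub>R u + h *\<^sub>R w) - g (x + s *\<^sub>R u + 0 *\<^sub>R w) =
      (h - 0) * frechet_derivative g (at (x + s *\<^sub>R u + t *\<^sub>R w)) w"
    by (rule MVT2[OF h]) (rule line[OF dg], use S s in auto)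
  then obtain t where t: "0 < t" "t < h" "g (x + s *\<^sub>R u + h *\<^sub>R w) - g (x + s *\<^sub>R u) =
      h * frechet_derivative g (at (x + s *\<^sub>R u + t *\<^sub>R w)) w" by auto
  have "f (x + h *\<^sub>R u + h *\<^sub>R w) - f (x + h *\<^sub>R u) - f (x + h *\<^sub>R w) + f x = \<psi> h - \<psi> 0"
    by (simp add: \<psi>_def)
  with s t show ?thesis
    by (intro exI[of _ s] exI[of _ t]) (auto simp: g_def)
qed

text \<open>One second difference, divided by \<open>h * h\<close>, equals each mixed derivative at
  some point near \<open>x\<close>. By continuity both mixed derivatives at \<open>x\<close> are
  within \<open>e / 2\<close> of that common value.\<close>

lemma second_derivative_symmetric:
  fixes f :: "'a::real_normed_vector \<Rightarrow> real"
  assumes f: "smooth_on S f" and S: "open S" "x \<in> S"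
  shows "frechet_derivative (\<lambda>y. frechet_derivative f (at y) u) (at x) w =
         frechet_derivative (\<lambda>y. frechet_derivative f (at y) w) (at x) u"
proof -
  define A where "A = (\<lambda>y. frechet_derivative (\<lambda>y. frechet_derivative f (at y) u) (at y) w)"
  define B where "B = (\<lambda>y. frechet_derivative (\<lambda>y. frechet_derivative f (at y) w) (at y) u)"
  have "continuous_on S A" "continuous_on S B"
    unfolding A_def B_def by (intro smooth_on_continuous smooth_on_frechet_derivative f)+
  then have c: "isCont A x" "isCont B x"
    using S by (auto simp: continuous_on_eq_continuous_at)
  have "\<bar>A x - B x\<bar> \<le> e" if e: "e > 0" for e
  proof -
    from c e obtain d1 d2 where d: "d1 > 0" "d2 > 0"
      "\<And>y. dist y x < d1 \<Longrightarrow> dist (A y) (A x) < e / 2" "\<And>y. dist y x < d2 \<Longrightarrow> dist (B y) (B x) < e / 2"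
      unfolding continuous_at_eps_delta by (metis half_gt_zero)
    obtain r where r: "r > 0" "ball x r \<subseteq> S" using S openE by blast
    define d where "d = Min {d1, d2, r}"
    have d0: "d > 0" "d \<le> d1" "d \<le> d2" "d \<le> r" using d r by (auto simp: d_def)
    \<comment> \<open>With this step the whole parallelogram stays within \<open>d / 2\<close> of
      \<open>x\<close>; the summand 1 keeps the denominator positive when both directions are
      zero.\<close>
    define h where "h = d / (2 * (norm u + norm w + 1))"
    have n: "norm u + norm w + 1 > 0" by (smt (verit) norm_ge_zero)
    have h: "h > 0" using d0 n by (simp add: h_def)
    \<comment> \<open>Only the sum of the norms is fixed, so that one estimate serves both orders of
      \<open>u\<close> and \<open>w\<close>.\<close>
    have near: "dist (x + s *\<^sub>R a + t *\<^sub>R b) x < d"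
      if "0 \<le> s" "s \<le> h" "0 \<le> t" "t \<le> h" "norm a + norm b = norm u + norm w" for s t a b
    proof -
      have "norm (s *\<^sub>R a + t *\<^sub>R b) \<le> s * norm a + t * norm b"
        using norm_triangle_ineq[of "s *\<^sub>R a" "t *\<^sub>R b"] that by simp
      also have "\<dots> \<le> h * norm a + h * norm b"
        using that by (intro add_mono mult_right_mono) auto
      also have "\<dots> = h * (norm u + norm w)" using that by (simp flip: distrib_left)
      also have "\<dots> \<le> h * (norm u + norm w + 1)" using h by (simp add: distrib_left)
      also have "\<dots> = d / 2" using n unfolding h_def by (metis mult.commute divide_divide_eq_left nonzero_mult_div_cancel_left times_divide_eq_right less_irrefl)
      also have "\<dots> < d" using d0 by simp
      finally show ?thesis by (simp add: dist_norm add.assoc)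
    qed
    have inS: "x + s *\<^sub>R a + t *\<^sub>R b \<in> S"
      if "0 \<le> s" "s \<le> h" "0 \<le> t" "t \<le> h" "norm a + norm b = norm u + norm w" for s t a b
      using near[OF that] d0 r by (auto simp: subset_iff dist_commute)
    obtain s t where 1: "0 \<le> s" "s \<le> h" "0 \<le> t" "t \<le> h"
      "f (x + h *\<^sub>R u + h *\<^sub>R w) - f (x + h *\<^sub>R u) - f (x + h *\<^sub>R w) + f x = h * h * A (x + s *\<^sub>R u + t *\<^sub>R w)"
      using second_derivative_mean_value[OF f h, of x u w] inS unfolding A_def by auto
    obtain s' t' where 2: "0 \<le> s'" "s' \<le> h" "0 \<le> t'" "t' \<le> h"
      "f (x + h *\<^sub>R w + h *\<^sub>R u) - f (x + h *\<^sub>R w) - f (x + h *\<^sub>R u) + f x = h * h * B (x + s' *\<^sub>R w + t' *\<^sub>R u)"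
      using second_derivative_mean_value[OF f h, of x w u] inS unfolding B_def by (auto simp: add.commute)
    have "h * h * A (x + s *\<^sub>R u + t *\<^sub>R w) = h * h * B (x + s' *\<^sub>R w + t' *\<^sub>R u)"
      using 1(5) 2(5) add.commute[of "h *\<^sub>R u" "h *\<^sub>R w"] by (simp only: add.assoc)
    then have "A (x + s *\<^sub>R u + t *\<^sub>R w) = B (x + s' *\<^sub>R w + t' *\<^sub>R u)" using h by simp
    moreover have "dist (A (x + s *\<^sub>R u + t *\<^sub>R w)) (A x) < e / 2"
      using near[of s t u w] 1 d0 by (intro d) auto
    moreover have "dist (B (x + s' *\<^sub>R w + t' *\<^sub>R u)) (B x) < e / 2"
      using near[of s' t' w u] 2 d0 by (intro d) auto
    ultimately show ?thesis unfolding dist_real_def by linarith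
  qed
  then have "A x = B x" by (metis abs_ge_zero abs_le_zero_iff dense_ge eq_iff_diff_eq_0)
  then show ?thesis by (simp add: A_def B_def)
qed

section \<open>Gradients, cofactors and Hessians\<close>

lemma linear_expand_axis:
  fixes L :: "real ^ 'n::finite \<Rightarrow> real"
  assumes "linear L"
  shows "L d = (\<Sum>i\<in>UNIV. d $ i * L (axis i 1))"
proof -
  have "L d = L (\<Sum>i\<in>UNIV. d $ i *\<^sub>R axis i 1)"
    using basis_expansion[of d] by (simp add: scalar_mult_eq_scaleR)
  then show ?thesis by (simp add: linear_sum[OF assms] linear_scale[OF assms])
qed

lemma gradient_inner:
  assumes "f differentiable (at x)"
  shows "gradient f x \<bullet> d = frechet_derivative f (at x) d"
  using linear_expand_axis[OF linear_frechet_derivative[OF assms], of d]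
  by (simp add: gradient_def partial_def inner_vec_def mult.commute)

lemma gradient_eqI:
  assumes "(f has_derivative (\<lambda>d. g \<bullet> d)) (at x)"
  shows "gradient f x = g"
  by (simp add: gradient_def partial_def frechet_derivative_eqI[OF assms] inner_axis)

lemma gradient_linear_family:
  fixes f :: "'k::finite \<Rightarrow> real ^ 'n::finite \<Rightarrow> real"
  assumes "h differentiable (at x)" "\<And>i. f i differentiable (at x)"
  shows "gradient (\<lambda>y. h y + (\<Sum>i\<in>UNIV. l $ i * f i y)) x =
    gradient h x + (\<Sum>i\<in>UNIV. l $ i *\<^sub>R gradient (f i) x)"
proof (rule gradient_eqI)
  show "((\<lambda>y. h y + (\<Sum>i\<in>UNIV. l $ i * f i y)) has_derivative
     (\<lambda>d. (gradient h x + (\<Sum>i\<in>UNIV. l $ i *\<^sub>R gradient (f i) x)) \<bullet> d)) (at x)"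
    by (auto intro!: derivative_eq_intros has_frechet_derivative assms
        simp: inner_add_left inner_sum_left gradient_inner assms)
qed

section \<open>Base and fibre parts of bundle coordinates\<close>

definition base_part :: "real ^ ('n::finite + 'n) \<Rightarrow> real ^ 'n" where
  "base_part z = (\<chi> i. z $ Inl i)"

definition fibre_part :: "real ^ ('n::finite + 'n) \<Rightarrow> real ^ 'n" where
  "fibre_part z = (\<chi> i. z $ Inr i)"

lemma base_part_join [simp]: "base_part (join x y) = x"
  by (simp add: base_part_def join_def)

lemma fibre_part_join [simp]: "fibre_part (join x y) = y"
  by (simp add: fibre_part_def join_def)

lemma join_base_fibre [simp]: "join (base_part z) (fibre_part z) = z"
  by (auto simp: base_part_def fibre_part_def join_def vec_eq_iff split: sum.split)

lemma join_eq_iff [simp]: "join x y = join x' y' \<longleftrightarrow> x = x' \<and> y = y'"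
  by (metis base_part_join fibre_part_join)

lemma bounded_linear_base_part: "bounded_linear base_part"
  unfolding linear_conv_bounded_linear[symmetric]
  by (auto simp: base_part_def vec_eq_iff intro!: linearI)

lemma bounded_linear_fibre_part: "bounded_linear fibre_part"
  unfolding linear_conv_bounded_linear[symmetric]
  by (auto simp: fibre_part_def vec_eq_iff intro!: linearI)

lemma canonical_form_parts:
  "canonical_form u w = fibre_part u \<bullet> base_part w - base_part u \<bullet> fibre_part w"
  by (simp add: canonical_form_def base_part_def fibre_part_def inner_vec_def sum_subtractf)

text \<open>Full rank makes the rows distinct and independent, so they extend to a basis, which has
  as many members as \<open>'n\<close> and can be indexed by it. The injection
  \<open>\<sigma>\<close> records where the given rows end up; it later splits the \<open>n\<close>
  equations into constraints and cofactor conditions.\<close>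

lemma full_rank_rows_extend:
  fixes r :: "'k::finite \<Rightarrow> real ^ 'n::finite"
  assumes "rank ((\<chi> i. r i) :: real ^ 'n ^ 'k) = CARD('k)"
  obtains \<sigma> :: "'k \<Rightarrow> 'n" and b :: "'n \<Rightarrow> real ^ 'n"
  where "inj \<sigma>" "\<And>i. b (\<sigma> i) = r i" "det (\<chi> s. b s) \<noteq> 0"
proof -
  have rows: "rows ((\<chi> i. r i) :: real ^ 'n ^ 'k) = range r"
    by (auto simp: rows_def row_def vec_lambda_eta)
  have dim: "dim (range r) = CARD('k)"
    using assms by (simp add: row_rank_def rows)
  \<comment> \<open>The dimension bounds the number of distinct rows from below, the index type
    bounds it from above.\<close>
  have card: "card (range r) = CARD('k)"
    using dim_le_card'[of "range r"] card_image_le[of UNIV r] dim by auto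
  have "inj r" by (rule eq_card_imp_inj_on) (auto simp: card)
  have ind: "independent (range r)"
    by (rule card_le_dim_spanning[of _ "range r"]) (auto simp: span_superset dim card)
  obtain B where B: "range r \<subseteq> B" "independent B" "UNIV \<subseteq> span B"
    using maximal_independent_subset_extend[OF _ ind, of UNIV] by auto
  have "finite B" using B(2) by (rule independent_imp_finite)
  moreover have "card B = CARD('n)"
    using basis_card_eq_dim[of B UNIV] B by simp
  ultimately obtain b :: "'n \<Rightarrow> real ^ 'n" where b: "bij_betw b UNIV B"
    using finite_same_card_bij[of "UNIV :: 'n set" B] by auto
  define \<sigma> where "\<sigma> = (\<lambda>i. inv_into UNIV b (r i))"
  have b\<sigma>: "b (\<sigma> i) = r i" for i
    unfolding \<sigma>_def using b B(1) by (auto intro!: f_inv_into_f simp: bij_betw_def)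
  have "inj \<sigma>" using \<open>inj r\<close> b\<sigma> by (metis injI injD)
  moreover have "det (\<chi> s. b s) \<noteq> 0"
  proof -
    have "rows (\<chi> s. b s) = B"
      using b by (auto simp: rows_def row_def vec_lambda_eta bij_betw_def)
    then have "invertible (\<chi> s. b s)"
      using B(3) matrix_left_invertible_span_rows[of "\<chi> s. b s"] invertible_left_inverse by auto
    then show ?thesis by (simp add: invertible_det_nz)
  qed
  ultimately show ?thesis using that b\<sigma> by blast
qed

text \<open>This is the determinant of \<open>M\<close> with row \<open>s\<close> replaced by
  \<open>w\<close>, expanded along that row. In the expanded form linearity in \<open>w\<close> is
  visible and the coefficients are free of \<open>w\<close>, which suits differentiation.\<close>

definition cofactor :: "real ^ 'n::finite ^ 'n \<Rightarrow> 'n \<Rightarrow> real ^ 'n \<Rightarrow> real" where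
  "cofactor M s w = (\<Sum>j\<in>UNIV. w $ j * det (\<chi> t. if t = s then axis j 1 else M $ t))"

lemma cofactor_diff: "cofactor M s (v - w) = cofactor M s v - cofactor M s w"
  by (simp add: cofactor_def algebra_simps sum_subtractf)

lemma cofactor_eq_det: "cofactor M s w = det (\<chi> t. if t = s then w else M $ t)"
proof -
  have "det (\<chi> t. if t = s then w else M $ t) =
      det (\<chi> t. if t = s then (\<Sum>j\<in>UNIV. w $ j *s axis j 1) else M $ t)"
    by (simp only: basis_expansion)
  also have "\<dots> = (\<Sum>j\<in>UNIV. det (\<chi> t. if t = s then w $ j *s axis j 1 else M $ t))"
    by (rule det_linear_row_sum[where a = "\<lambda>t j. w $ j *s axis j 1"]) simp
  also have "\<dots> = cofactor M s w"
    unfolding cofactor_def by (intro sum.cong refl det_row_mul[where a = "\<lambda>_. axis _ 1"])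
  finally show ?thesis by simp
qed

text \<open>Cramer's rule for the transposed matrix: up to the factor \<open>det M\<close>, the
  cofactor reads off the coefficient of row \<open>s\<close>. For invertible \<open>M\<close> its
  vanishing therefore says that row \<open>s\<close> does not occur.\<close>

lemma cofactor_row_combination:
  "cofactor M s (\<Sum>t\<in>UNIV. c t *\<^sub>R M $ t) = c s * det M"
proof -
  have "cofactor M s (\<Sum>t\<in>UNIV. c t *\<^sub>R M $ t) =
      det (\<chi> t. if t = s then \<Sum>t\<in>UNIV. (\<chi> t. c t) $ t *s row t M else row t M)"
    unfolding cofactor_eq_det
    by (rule arg_cong[where f = det]) (auto simp: vec_eq_iff row_def)
  then show ?thesis by (simp add: cramer_lemma_transpose)
qed

lemma row_combination_exists:
  fixes M :: "real ^ 'n::finite ^ 'n"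
  assumes "det M \<noteq> 0" shows "\<exists>c. w = (\<Sum>t\<in>UNIV. c t *\<^sub>R M $ t)"
proof -
  have "invertible (transpose M)"
    using assms by (simp add: invertible_det_nz det_transpose)
  then obtain B where "transpose M ** B = mat 1" unfolding invertible_def by blast
  then have "transpose M *v (B *v w) = w"
    by (simp add: matrix_vector_mul_assoc)
  then have "w = (\<Sum>t\<in>UNIV. (B *v w) $ t *\<^sub>R M $ t)"
    by (simp add: matrix_mult_sum scalar_mult_eq_scaleR row_def vec_lambda_eta)
  then show ?thesis by blast
qed

lemma matrix_vector_solve:
  fixes M :: "real ^ 'n::finite ^ 'n"
  assumes "det M \<noteq> 0" shows "\<exists>d. \<forall>t. M $ t \<bullet> d = y t"
proof -
  have "invertible M" using assms by (simp add: invertible_det_nz)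
  then obtain B where "M ** B = mat 1" unfolding invertible_def by blast
  then have "M *v (B *v (\<chi> t. y t)) = (\<chi> t. y t)"
    by (simp add: matrix_vector_mul_assoc)
  then have "M $ t \<bullet> (B *v (\<chi> t. y t)) = y t" for t
    by (metis matrix_vector_mul_component vec_lambda_beta)
  then show ?thesis by blast
qed

section \<open>The Hessian as the derivative of the gradient\<close>

definition hessian_apply :: "(real ^ 'n::finite \<Rightarrow> real) \<Rightarrow> real ^ 'n \<Rightarrow> real ^ 'n \<Rightarrow> real ^ 'n" where
  "hessian_apply f x d = (\<chi> j. frechet_derivative (partial j f) (at x) d)"

lemma has_derivative_gradient:
  assumes "smooth_on U f" "x \<in> U"
  shows "(gradient f has_derivative hessian_apply f x) (at x)"
proof -
  have "((\<lambda>y. gradient f y $ j) has_derivative (\<lambda>d. hessian_apply f x d $ j)) (at x)" for j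
    unfolding gradient_def hessian_apply_def
    using has_frechet_derivative[OF smooth_on_differentiable[OF smooth_on_partial[OF assms(1)] assms(2)]]
    by simp
  then show ?thesis
    by (subst has_derivative_componentwise_within) (auto simp: Basis_vec_def inner_axis)
qed

lemma hessian_apply_symmetric:
  assumes "smooth_on U f" "open U" "x \<in> U"
  shows "hessian_apply f x d \<bullet> e = hessian_apply f x e \<bullet> d"
proof -
  define S where "S i j = frechet_derivative (partial j f) (at x) (axis i 1)" for i j
  have S: "S i j = S j i" for i j
    unfolding S_def partial_def[abs_def] by (rule second_derivative_symmetric[OF assms])
  have "frechet_derivative (partial j f) (at x) a = (\<Sum>i\<in>UNIV. a $ i * S i j)" for j a
    unfolding S_def
    by (rule linear_expand_axis[OF linear_frechet_derivative[OF
          smooth_on_differentiable[OF smooth_on_partial[OF assms(1)] assms(3)]]])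
  then have H: "hessian_apply f x a \<bullet> b = (\<Sum>j\<in>UNIV. \<Sum>i\<in>UNIV. a $ i * S i j * b $ j)" for a b
    by (simp add: hessian_apply_def inner_vec_def sum_distrib_right)
  show ?thesis
    unfolding H by (subst sum.swap, intro sum.cong refl) (metis S mult.assoc mult.commute)
qed

section \<open>The local submersion\<close>

lemma linear_cofactor: "linear (cofactor M s)"
  by (auto simp: cofactor_def algebra_simps sum.distrib sum_distrib_left intro!: linearI)

lemma cofactor_row: "t \<noteq> s \<Longrightarrow> cofactor M s (M $ t) = 0"
  using cofactor_row_combination[of M s "\<lambda>r. if r = t then 1 else 0"]
  by (simp add: if_distrib[of "\<lambda>r. r *\<^sub>R _"] cong: if_cong)

lemma smooth_on_cofactor:
  assumes "open S" "\<And>i j. smooth_on S (\<lambda>z. M z $ i $ j)" "\<And>j. smooth_on S (\<lambda>z. w z $ j)"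
  shows "smooth_on S (\<lambda>z. cofactor (M z) s (w z))"
proof -
  have "smooth_on S (\<lambda>z. (if t = s then axis j 1 else M z $ t) $ i)" for t i and j :: 'b
    using assms(2) by (cases "t = s") (auto intro: smooth_on_const)
  then show ?thesis
    unfolding cofactor_def
    by (intro smooth_on_sum smooth_on_mult smooth_on_det assms) auto
qed

text \<open>Because \<open>w\<close> vanishes at \<open>z\<close>, the product rule keeps only the
  terms in which \<open>w\<close> is differentiated; the derivative of the matrix
  disappears.\<close>

lemma has_derivative_cofactor_zero:
  fixes M :: "'a::real_normed_vector \<Rightarrow> real ^ 'n::finite ^ 'n"
  assumes "open S" "z \<in> S" "\<And>i j. smooth_on S (\<lambda>z. M z $ i $ j)"
    and "(w has_derivative w') (at z)" "w z = 0"
  shows "((\<lambda>z. cofactor (M z) s (w z)) has_derivative (\<lambda>u. cofactor (M z) s (w' u))) (at z)"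
proof -
  define m where "m j = (\<lambda>z. det (\<chi> t. if t = s then axis j 1 else M z $ t))" for j
  have "smooth_on S (\<lambda>z. (if t = s then axis j 1 else M z $ t) $ i)" for t i and j :: 'n
    using assms(3) by (cases "t = s") (auto intro: smooth_on_const)
  then have "smooth_on S (m j)" for j
    unfolding m_def by (intro smooth_on_det assms) auto
  then have m: "(m j has_derivative frechet_derivative (m j) (at z)) (at z)" for j
    by (intro has_frechet_derivative smooth_on_differentiable[OF _ assms(2)])
  have w: "((\<lambda>z. w z $ j) has_derivative (\<lambda>u. w' u $ j)) (at z)" for j
    using bounded_linear.has_derivative[OF bounded_linear_vec_nth assms(4)] .
  have "((\<lambda>z. w z $ j * m j z) has_derivative (\<lambda>u. w' u $ j * m j z)) (at z)" for j
    using has_derivative_mult[OF w[of j] m[of j]] assms(5) by simp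
  then have "((\<lambda>z. \<Sum>j\<in>UNIV. w z $ j * m j z) has_derivative (\<lambda>u. \<Sum>j\<in>UNIV. w' u $ j * m j z)) (at z)"
    by (intro has_derivative_sum)
  then show ?thesis by (simp add: cofactor_def m_def)
qed

text \<open>Let \<open>G(x)\<close> have the gradients of the \<open>f\<^sub>i\<close> among its rows and constant vectors as the other
  rows, with \<open>det G \<noteq> 0\<close> near \<open>x\<^sub>0\<close>. By Cramer's rule, \<open>e - \<nabla>h(x)\<close> is a combination of the gradients
  if and only if \<open>cofactor (G x) s (e - \<nabla>h(x)) = 0\<close> for the remaining indices \<open>s\<close>. These functions
  and the \<open>f\<^sub>i\<close> define the submersion.\<close>

theorem local_lagrangian:
  fixes h :: "real ^ 'n::finite \<Rightarrow> real" and f :: "'k::finite \<Rightarrow> real ^ 'n \<Rightarrow> real"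
  assumes U: "open U" and h: "smooth_on U h" and f: "\<And>i. smooth_on U (f i)"
    and x0: "x0 \<in> U" and rank: "rank ((\<chi> i. gradient (f i) x0) :: real ^ 'n ^ 'k) = CARD('k)"
  shows "\<exists>V (F :: real ^ ('n + 'n) \<Rightarrow> real ^ 'n).
    open V \<and> V \<subseteq> {join x e | x e. x \<in> U} \<and> (\<forall>e. join x0 e \<in> V) \<and> smooth_on V F \<and>
    {z \<in> V. F z = 0} = {join x e | x e. x \<in> U \<and> (\<forall>i. f i x = 0) \<and>
      (\<exists>l. e = gradient h x + (\<Sum>i\<in>UNIV. l $ i *\<^sub>R gradient (f i) x))} \<inter> V \<and>
    (\<forall>z\<in>V. F z = 0 \<longrightarrow> surj (frechet_derivative F (at z)) \<and>
      (\<forall>u w. frechet_derivative F (at z) u = 0 \<longrightarrow> frechet_derivative F (at z) w = 0 \<longrightarrow>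
        canonical_form u w = 0))"
proof -
  obtain \<sigma> :: "'k \<Rightarrow> 'n" and b where \<sigma>: "inj \<sigma>" "\<And>i. b (\<sigma> i) = gradient (f i) x0" "det (\<chi> s. b s) \<noteq> 0"
    using full_rank_rows_extend[OF rank] by metis
  define \<tau> where "\<tau> = inv \<sigma>"
  have \<tau>: "\<tau> (\<sigma> i) = i" for i using \<sigma>(1) by (simp add: \<tau>_def)
  define G where "G x = (\<chi> s. if s \<in> range \<sigma> then gradient (f (\<tau> s)) x else b s)" for x
  have G\<sigma>: "G x $ \<sigma> i = gradient (f i) x" for x i by (simp add: G_def \<tau>)
  define g where "g l x = gradient h x + (\<Sum>i\<in>UNIV. l $ i *\<^sub>R gradient (f i) x)" for l x
  define W where "W = {x \<in> U. det (G x) \<noteq> 0}"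
  \<comment> \<open>The fibre coordinates are left free, so one \<open>V\<close> serves every
    \<open>e\<close> over \<open>x0\<close>.\<close>
  define V :: "(real ^ ('n + 'n)) set" where "V = base_part -` W"
  \<comment> \<open>The \<open>k\<close> indices in \<open>range \<sigma>\<close> carry the
    constraints and the other \<open>n - k\<close> the cofactor conditions, so \<open>F\<close> has
    exactly \<open>n\<close> components.\<close>
  define F :: "real ^ ('n + 'n) \<Rightarrow> real ^ 'n" where
    "F z = (\<chi> s. if s \<in> range \<sigma> then f (\<tau> s) (base_part z)
       else cofactor (G (base_part z)) s (fibre_part z - gradient h (base_part z)))" for z
  define Z where "Z = {join x e | x e. x \<in> U \<and> (\<forall>i. f i x = 0) \<and> (\<exists>l. e = g l x)}"

  have smooth_grad: "smooth_on U (\<lambda>x. gradient p x $ j)" if "smooth_on U p" for p j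
    using smooth_on_partial[OF that] by (simp add: gradient_def)
  have GU: "smooth_on U (\<lambda>x. G x $ i $ j)" for i j
    by (cases "i \<in> range \<sigma>") (auto simp: G_def intro!: smooth_grad f smooth_on_const)
  have "smooth_on U (\<lambda>x. det (G x))" by (intro smooth_on_det U GU)
  then have "open (U \<inter> (\<lambda>x. det (G x)) -` (- {0}))"
    by (intro continuous_open_preimage smooth_on_continuous U) auto
  moreover have "U \<inter> (\<lambda>x. det (G x)) -` (- {0}) = W" by (auto simp: W_def)
  ultimately have W: "open W" by simp
  have WU: "W \<subseteq> U" by (auto simp: W_def)
  have lin: "bounded_linear (base_part :: real ^ ('n + 'n) \<Rightarrow> _)"
    "bounded_linear (fibre_part :: real ^ ('n + 'n) \<Rightarrow> _)"
    by (rule bounded_linear_base_part bounded_linear_fibre_part)+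
  have V: "open V"
    using W continuous_open_vimage[OF _ linear_continuous_at[OF lin(1)]] by (simp add: V_def)
  have pull: "smooth_on V (\<lambda>z. p (base_part z))" if "smooth_on U p" for p :: "_ \<Rightarrow> real"
    by (rule smooth_on_compose_linear[OF lin(1) U V _ that]) (use WU in \<open>auto simp: V_def\<close>)
  have GV: "smooth_on V (\<lambda>z. G (base_part z) $ i $ j)" for i j by (rule pull[OF GU])
  have fib: "smooth_on V (\<lambda>z. fibre_part z $ j)" for j
    using smooth_on_bounded_linear[OF bounded_linear_compose[OF bounded_linear_vec_nth lin(2)] V] .
  have FV: "smooth_on V F"
  proof (rule smooth_on_vec[OF V])
    fix s
    show "smooth_on V (\<lambda>z. F z $ s)"
    proof (cases "s \<in> range \<sigma>")
      case True
      then show ?thesis using pull[OF f[of "\<tau> s"]] by (simp add: F_def)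
    next
      case False
      have "smooth_on V (\<lambda>z. cofactor (G (base_part z)) s (fibre_part z - gradient h (base_part z)))"
        unfolding vector_minus_component
        by (intro smooth_on_cofactor[OF V GV]) (auto intro!: smooth_on_diff V fib pull smooth_grad h)
      with False show ?thesis by (simp add: F_def)
    qed
  qed

  \<comment> \<open>For \<open>s\<close> outside \<open>range \<sigma>\<close>, inserting a
    constraint gradient into row \<open>s\<close> repeats another row.\<close>
  have cof_grad: "cofactor (G x) s (\<Sum>i\<in>UNIV. l $ i *\<^sub>R gradient (f i) x) = 0" if "s \<notin> range \<sigma>" for s x l
  proof -
    have "cofactor (G x) s (gradient (f i) x) = 0" for i
      using cofactor_row[of "\<sigma> i" s "G x"] that by (auto simp: G\<sigma>)
    then show ?thesis
      by (simp add: linear_sum[OF linear_cofactor] linear_scale[OF linear_cofactor])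
  qed
  \<comment> \<open>Expand \<open>w\<close> in the rows of \<open>G x\<close>: the vanishing
    cofactors kill the coefficients of the constant rows, and those of the gradients are the
    multipliers.\<close>
  have cof_zero: "\<exists>l. w = (\<Sum>i\<in>UNIV. l $ i *\<^sub>R gradient (f i) x)"
    if x: "x \<in> W" and w: "\<And>s. s \<notin> range \<sigma> \<Longrightarrow> cofactor (G x) s w = 0" for x w
  proof -
    have d: "det (G x) \<noteq> 0" using x by (simp add: W_def)
    obtain c where c: "w = (\<Sum>t\<in>UNIV. c t *\<^sub>R G x $ t)"
      using row_combination_exists[OF d, of w] by blast
    have "c s = 0" if "s \<notin> range \<sigma>" for s
      using d cofactor_row_combination[of "G x" s c] w[OF that] by (simp add: c)
    then have "w = (\<Sum>t\<in>range \<sigma>. c t *\<^sub>R G x $ t)"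
      unfolding c by (intro sum.mono_neutral_right) auto
    also have "\<dots> = (\<Sum>i\<in>UNIV. c (\<sigma> i) *\<^sub>R gradient (f i) x)"
      using sum.reindex[OF \<sigma>(1), of "\<lambda>t. c t *\<^sub>R G x $ t"] by (simp add: G\<sigma>)
    finally show ?thesis by (intro exI[of _ "\<chi> i. c (\<sigma> i)"]) simp
  qed
  have F0: "F z = 0 \<longleftrightarrow> z \<in> Z" if z: "z \<in> V" for z
  proof
    assume F: "F z = 0"
    have Fs: "F z $ s = 0" for s using F by simp
    have "f i (base_part z) = 0" for i using Fs[of "\<sigma> i"] by (simp add: F_def \<tau>)
    moreover obtain l where "fibre_part z - gradient h (base_part z) =
        (\<Sum>i\<in>UNIV. l $ i *\<^sub>R gradient (f i) (base_part z))"
    proof -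
      have "cofactor (G (base_part z)) s (fibre_part z - gradient h (base_part z)) = 0"
        if "s \<notin> range \<sigma>" for s
        using Fs[of s] that by (simp add: F_def)
      then show ?thesis using cof_zero[of "base_part z"] z that by (auto simp: V_def)
    qed
    then have "fibre_part z = g l (base_part z)" by (simp add: g_def algebra_simps)
    moreover have "base_part z \<in> U" using z WU by (auto simp: V_def)
    ultimately have "z = join (base_part z) (fibre_part z) \<and> base_part z \<in> U \<and>
        (\<forall>i. f i (base_part z) = 0) \<and> (\<exists>l. fibre_part z = g l (base_part z))"
      using join_base_fibre[of z, symmetric] by blast
    then show "z \<in> Z" unfolding Z_def by blast
  next
    assume "z \<in> Z"
    then obtain x l where x: "z = join x (g l x)" "\<And>i. f i x = 0" by (auto simp: Z_def)
    have "F z $ s = 0" for s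
      by (simp add: F_def x g_def cof_grad)
    then show "F z = 0" by (simp add: vec_eq_iff)
  qed
  \<comment> \<open>The function \<open>K\<close> depends on the zero \<open>z\<close>: it is the
    family with the multiplier of \<open>z\<close> frozen. Only at points of \<open>Z\<close> is
    there such a multiplier, and only there is this formula claimed.\<close>
  have deriv: "\<exists>K. smooth_on U K \<and> (\<forall>u. frechet_derivative F (at z) u =
        (\<chi> s. if s \<in> range \<sigma> then gradient (f (\<tau> s)) (base_part z) \<bullet> base_part u
         else cofactor (G (base_part z)) s (fibre_part u - hessian_apply K (base_part z) (base_part u))))"
    if z: "z \<in> V" "z \<in> Z" for z
  proof -
    define x where "x = base_part z"
    have x: "x \<in> U" using z WU by (auto simp: V_def x_def)
    obtain l where l: "fibre_part z = g l x" using z(2) by (auto simp: Z_def x_def)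
    define K where "K = (\<lambda>y. h y + (\<Sum>i\<in>UNIV. l $ i * f i y))"
    have K: "smooth_on U K"
      unfolding K_def by (intro smooth_on_add smooth_on_sum smooth_on_mult smooth_on_const U h f)
    have gK: "gradient K y = g l y" if "y \<in> U" for y
      unfolding K_def g_def
      by (intro gradient_linear_family smooth_on_differentiable[OF _ that] h f)
    define F' where "F' u = (\<chi> s. if s \<in> range \<sigma> then gradient (f (\<tau> s)) x \<bullet> base_part u
         else cofactor (G x) s (fibre_part u - hessian_apply K x (base_part u)))"
      for u :: "real ^ ('n + 'n)"
    have "((\<lambda>y. F y $ s) has_derivative (\<lambda>u. F' u $ s)) (at z)" for s
    proof (cases "s \<in> range \<sigma>")
      case True
      have "((\<lambda>y. f (\<tau> s) (base_part y)) has_derivative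
          (\<lambda>u. frechet_derivative (f (\<tau> s)) (at (base_part z)) (base_part u))) (at z)"
        by (rule has_derivative_compose[OF bounded_linear_imp_has_derivative[OF lin(1)]
              has_frechet_derivative[OF smooth_on_differentiable[OF f]]]) (use x in \<open>simp add: x_def\<close>)
      with True show ?thesis
        using gradient_inner[OF smooth_on_differentiable[OF f x]] by (simp add: F_def F'_def x_def)
    next
      case False
      have grad: "((\<lambda>y. gradient K (base_part y)) has_derivative
          (\<lambda>u. hessian_apply K (base_part z) (base_part u))) (at z)"
        by (rule has_derivative_compose[OF bounded_linear_imp_has_derivative[OF lin(1)]
              has_derivative_gradient[OF K]]) (use x in \<open>simp add: x_def\<close>)
      have "((\<lambda>y. cofactor (G (base_part y)) s (fibre_part y - gradient K (base_part y))) has_derivative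
          (\<lambda>u. cofactor (G (base_part z)) s
             (fibre_part u - hessian_apply K (base_part z) (base_part u)))) (at z)"
        by (intro has_derivative_cofactor_zero[OF V z(1) GV] has_derivative_diff grad
            bounded_linear_imp_has_derivative lin(2)) (use l gK[OF x] in \<open>simp add: x_def\<close>)
      \<comment> \<open>Exchanging \<open>h\<close> for \<open>K\<close> changes the argument by a
        combination of constraint gradients, which these cofactors annihilate. The two expressions
        thus agree on all of \<open>V\<close>, so they have the same derivative at
        \<open>z\<close>.\<close>
      moreover have "cofactor (G (base_part y)) s (fibre_part y - gradient K (base_part y)) = F y $ s"
        if "y \<in> V" for y
      proof -
        have "base_part y \<in> U" using that WU by (auto simp: V_def)
        then have e: "fibre_part y - gradient K (base_part y) = fibre_part y - gradient h (base_part y)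
            - (\<Sum>i\<in>UNIV. l $ i *\<^sub>R gradient (f i) (base_part y))"
          by (simp add: gK g_def)
        show ?thesis
          unfolding e cofactor_diff[of _ _ "fibre_part y - gradient h (base_part y)"]
          using False by (simp add: cof_grad F_def)
      qed
      ultimately have "((\<lambda>y. F y $ s) has_derivative
          (\<lambda>u. cofactor (G (base_part z)) s
             (fibre_part u - hessian_apply K (base_part z) (base_part u)))) (at z)"
        by (rule has_derivative_transform_within_open[OF _ V z(1)])
      with False show ?thesis by (simp add: F'_def x_def)
    qed
    then have "(F has_derivative F') (at z)"
      by (subst has_derivative_componentwise_within) (auto simp: Basis_vec_def inner_axis)
    then have F': "frechet_derivative F (at z) = F'" by (rule frechet_derivative_eqI)
    show ?thesis
      by (intro exI[of _ K] conjI K allI) (simp only: F' F'_def x_def)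
  qed
  have surj: "surj (frechet_derivative F (at z))"
    and isotropic: "frechet_derivative F (at z) u = 0 \<Longrightarrow> frechet_derivative F (at z) w = 0 \<Longrightarrow>
      canonical_form u w = 0" if z: "z \<in> V" "F z = 0" for z u w
  proof -
    define x where "x = base_part z"
    have x: "x \<in> W" "x \<in> U" "det (G x) \<noteq> 0" using z WU by (auto simp: V_def W_def x_def)
    obtain K where K: "smooth_on U K" and F': "\<And>u. frechet_derivative F (at z) u =
        (\<chi> s. if s \<in> range \<sigma> then gradient (f (\<tau> s)) x \<bullet> base_part u
         else cofactor (G x) s (fibre_part u - hessian_apply K x (base_part u)))"
      using deriv[OF z(1)] z F0[OF z(1)] unfolding x_def by blast
    show "surj (frechet_derivative F (at z))"
    proof (rule surjI)
      fix y :: "real ^ 'n"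
      \<comment> \<open>The base part \<open>d\<close> meets the equations for the gradients. The
        fibre part contains the Hessian term of \<open>d\<close>, which the derivative subtracts
        again, and a row combination divided by \<open>det (G x)\<close>, whose cofactor at
        \<open>s\<close> is \<open>y $ s\<close> by Cramer's rule. A choice operator is used since a
        right inverse has to be a function of \<open>y\<close>.\<close>
      define d where "d = (SOME d. \<forall>t. G x $ t \<bullet> d = y $ t)"
      have d: "\<forall>t. G x $ t \<bullet> d = y $ t"
        unfolding d_def by (rule someI_ex[OF matrix_vector_solve[OF x(3)]])
      have "gradient (f i) x \<bullet> d = y $ \<sigma> i" for i using d G\<sigma> by metis
      then show "frechet_derivative F (at z) ((\<lambda>y. let d = (SOME d. \<forall>t. G x $ t \<bullet> d = y $ t) in
          join d (hessian_apply K x d + (\<Sum>t\<in>UNIV. (y $ t / det (G x)) *\<^sub>R G x $ t))) y) = y"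
        using x(3) by (auto simp: F' Let_def vec_eq_iff cofactor_row_combination \<tau> simp flip: d_def)
    qed
    have parts: "(\<forall>i. gradient (f i) x \<bullet> base_part u = 0) \<and>
        (\<exists>l. fibre_part u = hessian_apply K x (base_part u) + (\<Sum>i\<in>UNIV. l $ i *\<^sub>R gradient (f i) x))"
      if "frechet_derivative F (at z) u = 0" for u
    proof -
      have s: "(if s \<in> range \<sigma> then gradient (f (\<tau> s)) x \<bullet> base_part u
         else cofactor (G x) s (fibre_part u - hessian_apply K x (base_part u))) = 0" for s
        using that unfolding F' by (simp add: vec_eq_iff)
      have "gradient (f i) x \<bullet> base_part u = 0" for i using s[of "\<sigma> i"] by (simp add: \<tau>)
      moreover have "\<exists>l. fibre_part u - hessian_apply K x (base_part u) =
          (\<Sum>i\<in>UNIV. l $ i *\<^sub>R gradient (f i) x)"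
        by (rule cof_zero[OF x(1)]) (use s in metis)
      ultimately show ?thesis by (metis add_diff_cancel_left' diff_add_cancel add.commute)
    qed
    assume "frechet_derivative F (at z) u = 0" "frechet_derivative F (at z) w = 0"
    \<comment> \<open>The multiplier terms pair constraint gradients with base parts orthogonal to
      them and drop out, leaving the two Hessian terms.\<close>
    from this[THEN parts] show "canonical_form u w = 0"
      using hessian_apply_symmetric[OF K U x(2), of "base_part u" "base_part w"]
      by (auto simp: canonical_form_parts inner_add_left inner_sum_left inner_add_right inner_sum_right
          inner_commute)
  qed
  have "V \<subseteq> {join x e | x e. x \<in> U}"
  proof
    fix z assume "z \<in> V"
    then have "z = join (base_part z) (fibre_part z) \<and> base_part z \<in> U" using WU by (auto simp: V_def)
    then show "z \<in> {join x e | x e. x \<in> U}" by blast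
  qed
  moreover have "G x0 = (\<chi> s. b s)"
    by (auto simp: G_def vec_eq_iff \<sigma>(2) \<tau>)
  then have "join x0 e \<in> V" for e using \<sigma>(3) x0 by (simp add: V_def W_def)
  moreover have "{z \<in> V. F z = 0} = Z \<inter> V" using F0 by blast
  ultimately show ?thesis
    using V FV surj isotropic unfolding Z_def g_def by (intro exI[of _ V] exI[of _ F]) blast
qed

section \<open>Charts of cotangent bundles\<close>

text \<open>Gradients and covectors transform by first derivatives of the transitions. Recording
  just this order lets the chart calculus apply both to \<open>Q\<close> and to
  \<open>cotangent_bundle Q\<close>, whose transitions already contain derivatives of those of
  \<open>Q\<close>.\<close>

definition differentiable_atlas :: "('a, 'n::finite) chart set \<Rightarrow> bool" where
  "differentiable_atlas A \<longleftrightarrow>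
     (\<forall>c\<in>A. inj_on (snd c) (fst c) \<and> open (chart_image c)) \<and>
     (\<forall>c\<in>A. \<forall>c'\<in>A. open (snd c ` (fst c \<inter> fst c')) \<and>
        (\<forall>q\<in>fst c \<inter> fst c'. transition c c' differentiable (at (snd c q))))"

lemma smooth_manifold_differentiable_atlas:
  "smooth_manifold A \<Longrightarrow> differentiable_atlas A"
  unfolding smooth_manifold_def differentiable_atlas_def
  using smooth_on_differentiable by blast

lemma charts_at_iff: "c \<in> charts_at A q \<longleftrightarrow> c \<in> A \<and> q \<in> fst c"
  by (auto simp: charts_at_def)

lemma points_charts_at: "c \<in> charts_at A q \<Longrightarrow> q \<in> points A"
  by (auto simp: charts_at_def points_def)

section \<open>Chart changes to first order\<close>

context
  fixes A :: "('a, 'n::finite) chart set"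
  assumes A: "differentiable_atlas A"
begin

lemma chart_inv_apply: "c \<in> A \<Longrightarrow> q \<in> fst c \<Longrightarrow> chart_inv c (snd c q) = q"
  using A by (simp add: differentiable_atlas_def)

lemma transition_apply: "c \<in> A \<Longrightarrow> q \<in> fst c \<Longrightarrow> transition c c' (snd c q) = snd c' q"
  by (simp add: transition_def chart_inv_apply)

lemma open_chart_image: "c \<in> A \<Longrightarrow> open (chart_image c)"
  using A by (simp add: differentiable_atlas_def)

lemma open_overlap: "c \<in> A \<Longrightarrow> c' \<in> A \<Longrightarrow> open (snd c ` (fst c \<inter> fst c'))"
  using A by (simp add: differentiable_atlas_def)

lemma transition_has_derivative:
  "c \<in> charts_at A q \<Longrightarrow> c' \<in> charts_at A q \<Longrightarrow>
    (transition c c' has_derivative frechet_derivative (transition c c') (at (snd c q))) (at (snd c q))"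
  using A by (intro has_frechet_derivative) (auto simp: differentiable_atlas_def charts_at_iff)

lemma linear_transition_derivative:
  "c \<in> charts_at A q \<Longrightarrow> c' \<in> charts_at A q \<Longrightarrow>
    linear (frechet_derivative (transition c c') (at (snd c q)))"
  by (rule has_derivative_linear[OF transition_has_derivative])

text \<open>On the chart overlap \<open>F\<close> is \<open>G\<close> after the transition, so this
  is the chain rule. Agreement near the point is enough because overlaps have open coordinate
  images.\<close>

lemma chart_change_derivative:
  assumes c: "c \<in> charts_at A q" "c' \<in> charts_at A q"
    and G: "(G has_derivative G') (at (snd c' q))"
    and S: "open S" "snd c q \<in> S" "\<And>r. r \<in> fst c \<Longrightarrow> snd c r \<in> S \<Longrightarrow> r \<in> fst c' \<Longrightarrow> F (snd c r) = G (snd c' r)"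
  shows "(F has_derivative (\<lambda>w. G' (frechet_derivative (transition c c') (at (snd c q)) w))) (at (snd c q))"
proof -
  have cA: "c \<in> A" "q \<in> fst c" "c' \<in> A" "q \<in> fst c'" using c by (auto simp: charts_at_iff)
  have 1: "((\<lambda>y. G (transition c c' y)) has_derivative
      (\<lambda>w. G' (frechet_derivative (transition c c') (at (snd c q)) w))) (at (snd c q))"
    by (rule has_derivative_compose[OF transition_has_derivative[OF c]]) (use G cA in \<open>simp add: transition_apply\<close>)
  have 2: "open (S \<inter> snd c ` (fst c \<inter> fst c'))" "snd c q \<in> S \<inter> snd c ` (fst c \<inter> fst c')"
    using cA S by (auto intro: open_overlap)
  show ?thesis
    by (rule has_derivative_transform_within_open[OF 1 2]) (use S(3) cA in \<open>auto simp: transition_apply\<close>)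
qed

lemma transition_derivative_cocycle:
  assumes "c \<in> charts_at A q" "c' \<in> charts_at A q" "c'' \<in> charts_at A q"
  shows "frechet_derivative (transition c c'') (at (snd c q)) w =
    frechet_derivative (transition c' c'') (at (snd c' q)) (frechet_derivative (transition c c') (at (snd c q)) w)"
proof -
  have "(transition c c'' has_derivative (\<lambda>w. frechet_derivative (transition c' c'') (at (snd c' q))
      (frechet_derivative (transition c c') (at (snd c q)) w))) (at (snd c q))"
    by (rule chart_change_derivative[OF assms(1,2) transition_has_derivative[OF assms(2,3)] open_UNIV])
      (use assms in \<open>auto simp: transition_apply charts_at_iff\<close>)
  then show ?thesis by (simp add: frechet_derivative_eqI)
qed

lemma transition_derivative_refl:
  assumes "c \<in> charts_at A q"
  shows "frechet_derivative (transition c c) (at (snd c q)) w = w"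
proof -
  have "c \<in> A" "snd c q \<in> chart_image c" using assms by (auto simp: charts_at_iff)
  then have "(transition c c has_derivative (\<lambda>w. w)) (at (snd c q))"
    by (intro has_derivative_transform_within_open[OF has_derivative_ident open_chart_image])
      (auto simp: transition_apply)
  then show ?thesis by (simp add: frechet_derivative_eqI)
qed

lemma gradient_chart_change:
  assumes "c \<in> charts_at A q" "c' \<in> charts_at A q" "(f \<circ> chart_inv c') differentiable (at (snd c' q))"
  shows "gradient (f \<circ> chart_inv c) (snd c q) \<bullet> w =
    gradient (f \<circ> chart_inv c') (snd c' q) \<bullet> frechet_derivative (transition c c') (at (snd c q)) w"
proof -
  have "((f \<circ> chart_inv c) has_derivative (\<lambda>w. frechet_derivative (f \<circ> chart_inv c') (at (snd c' q))
      (frechet_derivative (transition c c') (at (snd c q)) w))) (at (snd c q))" (is "(_ has_derivative ?D) _")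
    by (rule chart_change_derivative[OF assms(1,2) has_frechet_derivative[OF assms(3)] open_UNIV])
      (use assms in \<open>auto simp: chart_inv_apply charts_at_iff\<close>)
  then have "(f \<circ> chart_inv c) differentiable (at (snd c q))" "frechet_derivative (f \<circ> chart_inv c) (at (snd c q)) = ?D"
    by (auto simp: differentiable_def frechet_derivative_eqI)
  then show ?thesis by (simp add: gradient_inner assms(3))
qed

lemma cotangent_spaceD:
  "p \<in> cotangent_space A q \<Longrightarrow> c \<in> charts_at A q \<Longrightarrow> c' \<in> charts_at A q \<Longrightarrow>
    p c \<bullet> w = p c' \<bullet> frechet_derivative (transition c c') (at (snd c q)) w"
  unfolding cotangent_space_def by blast

lemma cotangent_component:
  "p \<in> cotangent_space A q \<Longrightarrow> c \<in> charts_at A q \<Longrightarrow> c' \<in> charts_at A q \<Longrightarrow>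
    p c' = (\<chi> i. p c \<bullet> frechet_derivative (transition c' c) (at (snd c' q)) (axis i 1))"
  using cotangent_spaceD[of p q c' c "axis _ 1"] by (simp add: vec_eq_iff inner_axis)

lemma cotangent_eqI:
  assumes "p \<in> cotangent_space A q" "p' \<in> cotangent_space A q" "c \<in> charts_at A q" "p c = p' c"
  shows "p = p'"
proof
  fix c'
  show "p c' = p' c'"
  proof (cases "c' \<in> charts_at A q")
    case True
    then show ?thesis using cotangent_component[of _ q c c'] assms by metis
  next
    case False
    then show ?thesis
      using assms(1,2) unfolding cotangent_space_def mem_Collect_eq by metis
  qed
qed

text \<open>The component in one chart can be prescribed freely: the others are obtained by pulling
  \<open>e\<close> back along the transitions into \<open>c\<close>, and the cocycle rule makes them
  consistent.\<close>

lemma covector_exists: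
  assumes "c \<in> charts_at A q"
  obtains p where "p \<in> cotangent_space A q" "p c = e"
proof -
  define p where "p c' = (if c' \<in> charts_at A q then
      \<chi> i. e \<bullet> frechet_derivative (transition c' c) (at (snd c' q)) (axis i 1) else 0)" for c'
  have p: "p c' \<bullet> w = e \<bullet> frechet_derivative (transition c' c) (at (snd c' q)) w"
    if "c' \<in> charts_at A q" for c' w
  proof -
    let ?D = "\<lambda>w. e \<bullet> frechet_derivative (transition c' c) (at (snd c' q)) w"
    have "linear ?D"
      using linear_compose[OF linear_transition_derivative[OF that assms]
          bounded_linear.linear[OF bounded_linear_inner_right[of e]]] by (simp add: o_def)
    then have "?D w = (\<Sum>i\<in>UNIV. w $ i * ?D (axis i 1))" by (rule linear_expand_axis)
    also have "\<dots> = p c' \<bullet> w"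
      using that by (simp add: p_def inner_vec_def[of _ w] mult.commute)
    finally show ?thesis by simp
  qed
  have "p \<in> cotangent_space A q"
    unfolding cotangent_space_def mem_Collect_eq
  proof (intro conjI allI impI ballI)
    fix c' assume "c' \<notin> charts_at A q"
    then show "p c' = 0" by (simp add: p_def)
  next
    fix c' c'' w assume *: "c' \<in> charts_at A q" "c'' \<in> charts_at A q"
    show "p c' \<bullet> w = p c'' \<bullet> frechet_derivative (transition c' c'') (at (snd c' q)) w"
      unfolding p[OF *(1)] p[OF *(2)] transition_derivative_cocycle[OF * assms] ..
  qed
  moreover have "p c \<bullet> w = e \<bullet> w" for w
    using assms by (simp add: p transition_derivative_refl)
  then have "p c = e" by (rule vector_eq_rdot[THEN iffD1, OF allI])
  ultimately show ?thesis using that by blast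
qed

text \<open>Both sides obey the same transformation law, so one chart decides. This settles the
  condition in \<open>generated_submanifold\<close>, which ranges over all charts around the
  point.\<close>

lemma gradient_covectorI:
  assumes p: "p \<in> cotangent_space A q" and c: "c \<in> charts_at A q" "c' \<in> charts_at A q"
    and f: "(f \<circ> chart_inv c) differentiable (at (snd c q))"
    and pc: "p c = gradient (f \<circ> chart_inv c) (snd c q)"
  shows "p c' = gradient (f \<circ> chart_inv c') (snd c' q)"
proof -
  have "p c' \<bullet> w = gradient (f \<circ> chart_inv c') (snd c' q) \<bullet> w" for w
    using cotangent_spaceD[OF p c(2,1)] gradient_chart_change[OF c(2,1) f] pc by simp
  then show ?thesis by (rule vector_eq_rdot[THEN iffD1, OF allI])
qed

text \<open>Every vector is the component of some covector, so the fibre coordinates are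
  unrestricted and the overlap is a full cylinder. For \<open>c' = c\<close> this gives the chart
  image.\<close>

lemma cotangent_chart_overlap:
  assumes "c \<in> A" "c' \<in> A"
  shows "snd (cotangent_chart A c) ` (fst (cotangent_chart A c) \<inter> fst (cotangent_chart A c')) =
    base_part -` (snd c ` (fst c \<inter> fst c'))" (is "?L = ?R")
proof
  show "?L \<subseteq> ?R" by (auto simp: cotangent_chart_def)
  show "?R \<subseteq> ?L"
  proof
    fix z assume "z \<in> ?R"
    then obtain q where q: "q \<in> fst c" "q \<in> fst c'" "base_part z = snd c q" by auto
    obtain p where p: "p \<in> cotangent_space A q" "p c = fibre_part z"
      using covector_exists[of c q] q assms by (auto simp: charts_at_iff)
    have "z = snd (cotangent_chart A c) (q, p)"
      using p(2) q(3) join_base_fibre[of z] by (simp add: cotangent_chart_def)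
    moreover have "(q, p) \<in> fst (cotangent_chart A c) \<inter> fst (cotangent_chart A c')"
      using p q by (simp add: cotangent_chart_def)
    ultimately show "z \<in> ?L" by blast
  qed
qed

lemma cotangent_chart_image:
  "c \<in> A \<Longrightarrow> chart_image (cotangent_chart A c) = base_part -` chart_image c"
  using cotangent_chart_overlap[of c c] by simp

lemma inj_on_cotangent_chart:
  assumes "c \<in> A"
  shows "inj_on (snd (cotangent_chart A c)) (fst (cotangent_chart A c))"
proof -
  have "inj_on (snd c) (fst c)" using A assms by (simp add: differentiable_atlas_def)
  then show ?thesis
    using cotangent_eqI[of _ _ _ c] assms
    by (auto simp: inj_on_def cotangent_chart_def charts_at_iff)
qed

end

lemma has_derivative_join:
  assumes "(a has_derivative a') (at x)" "(b has_derivative b') (at x)"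
  shows "((\<lambda>z. join (a z) (b z)) has_derivative (\<lambda>u. join (a' u) (b' u))) (at x)"
proof -
  have "bounded_linear (\<lambda>p. join (fst p) (snd p))"
    unfolding linear_conv_bounded_linear[symmetric]
    by (auto intro!: linearI simp: join_def vec_eq_iff split: sum.split)
  from bounded_linear.has_derivative[OF this has_derivative_Pair[OF assms]] show ?thesis by simp
qed

lemma differentiable_vec:
  fixes f :: "_ \<Rightarrow> real ^ 'n::finite"
  assumes "\<And>i. (\<lambda>x. f x $ i) differentiable (at x)"
  shows "f differentiable (at x)"
  by (subst differentiable_componentwise_within) (auto simp: Basis_vec_def inner_axis assms)

text \<open>A change of canonical coordinates moves the base point by the transition and the
  covector by the derivative of the inverse transition at the new base point. Differentiating the
  second part takes a second derivative of a transition of \<open>Q\<close>, which smoothness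
  provides.\<close>

theorem cotangent_bundle_differentiable_atlas:
  fixes A :: "('a, 'n::finite) chart set"
  assumes sm: "smooth_manifold A"
  shows "differentiable_atlas (cotangent_bundle A)"
proof -
  note A = smooth_manifold_differentiable_atlas[OF sm]
  have lin: "bounded_linear (base_part :: real ^ ('n + 'n) \<Rightarrow> _)"
    "bounded_linear (fibre_part :: real ^ ('n + 'n) \<Rightarrow> _)"
    by (rule bounded_linear_base_part bounded_linear_fibre_part)+
  have op: "open ((base_part :: real ^ ('n + 'n) \<Rightarrow> _) -` S)" if "open S" for S
    using that continuous_open_vimage[OF _ linear_continuous_at[OF lin(1)]] by simp
  have trans: "transition (cotangent_chart A c) (cotangent_chart A c') differentiable
      (at (snd (cotangent_chart A c) \<xi>))"
    if c: "c \<in> A" "c' \<in> A" and \<xi>: "\<xi> \<in> fst (cotangent_chart A c) \<inter> fst (cotangent_chart A c')"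
    for c c' \<xi>
  proof -
    let ?C = "cotangent_chart A c" and ?C' = "cotangent_chart A c'"
    obtain q p where qp: "\<xi> = (q, p)" "q \<in> fst c" "q \<in> fst c'" "p \<in> cotangent_space A q"
      using \<xi> by (auto simp: cotangent_chart_def)
    have at: "c \<in> charts_at A q" "c' \<in> charts_at A q" using c qp by (auto simp: charts_at_iff)
    define z where "z = snd ?C \<xi>"
    have bz: "base_part z = snd c q" by (simp add: z_def qp(1) cotangent_chart_def)
    define W where "W = snd c ` (fst c \<inter> fst c')"
    have W: "open W" "snd c q \<in> W" using open_overlap[OF A] c qp by (auto simp: W_def)
    have W': "open (snd c' ` (fst c' \<inter> fst c))" "snd c' q \<in> snd c' ` (fst c' \<inter> fst c)"
      using open_overlap[OF A] c qp by auto
    define D where "D i y = frechet_derivative (transition c' c) (at y) (axis i 1)" for i y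
    have "smooth_on (snd c' ` (fst c' \<inter> fst c)) (transition c' c)"
      using sm c by (simp add: smooth_manifold_def)
    then have "D i differentiable (at (snd c' q))" for i
      using smooth_on_differentiable[OF smooth_on_frechet_derivative W'(2)] by (simp add: D_def[abs_def])
    then have D: "(D i has_derivative frechet_derivative (D i) (at (snd c' q))) (at (snd c' q))" for i
      by (rule has_frechet_derivative)
    define \<tau> where "\<tau> = (\<lambda>z :: real ^ ('n + 'n). transition c c' (base_part z))"
    have \<tau>: "(\<tau> has_derivative (\<lambda>u. frechet_derivative (transition c c') (at (snd c q)) (base_part u))) (at z)"
      unfolding \<tau>_def
      by (rule has_derivative_compose[OF bounded_linear_imp_has_derivative[OF lin(1)]])
        (use transition_has_derivative[OF A at] bz in simp)
    have \<tau>z: "\<tau> z = snd c' q" using transition_apply[OF A c(1) qp(2)] bz by (simp add: \<tau>_def)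
    \<comment> \<open>This explicit formula makes sense on the whole coordinate space; it has to
      agree with the transition only on the open cylinder over \<open>W\<close>.\<close>
    define T where "T z = join (\<tau> z) (\<chi> i. fibre_part z \<bullet> D i (\<tau> z))" for z
    have "(\<lambda>z. D i (\<tau> z)) differentiable (at z)" for i
      using has_derivative_compose[OF \<tau>, of "D i"] D \<tau>z unfolding differentiable_def by auto
    then have "(\<lambda>z. fibre_part z \<bullet> D i (\<tau> z)) differentiable (at z)" for i
      using has_derivative_inner[OF bounded_linear_imp_has_derivative[OF lin(2)]]
      unfolding differentiable_def by blast
    then have "(\<lambda>z. \<chi> i. fibre_part z \<bullet> D i (\<tau> z)) differentiable (at z)"
      by (intro differentiable_vec) simp
    then have "T differentiable (at z)"
      unfolding T_def[abs_def] using has_derivative_join[OF \<tau>] unfolding differentiable_def by blast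
    moreover have "T y = transition ?C ?C' y" if y: "y \<in> base_part -` W" for y
    proof -
      have "y \<in> snd ?C ` (fst ?C \<inter> fst ?C')"
        using y cotangent_chart_overlap[OF A c] by (simp add: W_def)
      then obtain r s where rs: "y = snd ?C (r, s)" "r \<in> fst c" "r \<in> fst c'" "s \<in> cotangent_space A r"
        "(r, s) \<in> fst ?C"
        by (auto simp: cotangent_chart_def)
      have "transition ?C ?C' y = snd ?C' (r, s)"
        using inv_into_f_f[OF inj_on_cotangent_chart[OF A c(1)] rs(5)] by (simp add: rs(1) transition_def)
      moreover have "s c' = (\<chi> i. s c \<bullet> D i (snd c' r))"
        using cotangent_component[OF A rs(4), of c c'] rs c by (simp add: D_def charts_at_iff)
      moreover have "\<tau> y = snd c' r" "fibre_part y = s c"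
        using transition_apply[OF A c(1) rs(2)] by (auto simp: \<tau>_def rs(1) cotangent_chart_def)
      ultimately show ?thesis by (simp add: T_def cotangent_chart_def)
    qed
    ultimately show ?thesis
      using frechet_derivative_cong_open(1)[OF op[OF W(1)], of z T] W(2) bz by (simp add: z_def)
  qed
  show ?thesis
    unfolding differentiable_atlas_def cotangent_bundle_def
    using inj_on_cotangent_chart[OF A] cotangent_chart_image[OF A] cotangent_chart_overlap[OF A]
      op[OF open_chart_image[OF A]] op[OF open_overlap[OF A]] trans by auto
qed

section \<open>The Dirac--Bergmann Hamiltonian as a Morse family\<close>

lemma smooth_functionD:
  "smooth_function A f \<Longrightarrow> c \<in> A \<Longrightarrow> smooth_on (chart_image c) (f \<circ> chart_inv c)"
  by (simp add: smooth_function_def)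

lemma smooth_function_add_mult:
  assumes A: "differentiable_atlas A"
    and "smooth_function A f" "smooth_function A u" "smooth_function A g"
  shows "smooth_function A (\<lambda>x. f x + u x * g x)"
  unfolding smooth_function_def o_def
  by (intro ballI smooth_on_add smooth_on_mult open_chart_image[OF A])
    (use assms(2-4)[THEN smooth_functionD] in \<open>simp_all add: o_def\<close>)

text \<open>New constraints and coefficients are smooth by the premises of the rules. Only
  \<open>determine\<close> builds further functions, by substituting a solved multiplier, and these
  have the form treated in \<open>smooth_function_add_mult\<close>.\<close>

lemma dirac_stage_smooth:
  assumes A: "differentiable_atlas (cotangent_bundle Q)" and "dirac_stage Q L N H \<Theta> \<rho>"
  shows "smooth_function (cotangent_bundle Q) H \<and>
    (\<forall>\<psi>\<in>set (\<Theta> @ \<rho>). smooth_function (cotangent_bundle Q) \<psi>)"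
  using assms(2)
proof (induction rule: dirac_stage.induct)
  case (determine H \<Theta>\<^sub>1 \<theta> \<Theta>\<^sub>2 \<rho> \<psi> u b)
  then have smooth: "smooth_function (cotangent_bundle Q) H" "smooth_function (cotangent_bundle Q) \<theta>"
    "\<And>\<eta>. \<eta> \<in> set (\<Theta>\<^sub>1 @ \<Theta>\<^sub>2) \<Longrightarrow> smooth_function (cotangent_bundle Q) \<eta>"
    "\<And>\<eta>. \<eta> \<in> set \<rho> \<Longrightarrow> smooth_function (cotangent_bundle Q) \<eta>"
    by auto
  show ?case
  proof (intro conjI ballI)
    show "smooth_function (cotangent_bundle Q) (\<lambda>x. H x + u x * \<theta> x)"
      by (rule smooth_function_add_mult[OF A smooth(1) determine.hyps(4) smooth(2)])
    fix \<psi>'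
    assume "\<psi>' \<in> set (map2 (\<lambda>\<eta> \<beta> x. \<eta> x + \<beta> x * \<theta> x) (\<Theta>\<^sub>1 @ \<Theta>\<^sub>2) b @ \<theta> # \<rho>)"
    then consider \<eta> \<beta> where "(\<eta>, \<beta>) \<in> set (zip (\<Theta>\<^sub>1 @ \<Theta>\<^sub>2) b)" "\<psi>' = (\<lambda>x. \<eta> x + \<beta> x * \<theta> x)"
      | "\<psi>' = \<theta>" | "\<psi>' \<in> set \<rho>"
      by auto
    then show "smooth_function (cotangent_bundle Q) \<psi>'"
    proof cases
      case (1 \<eta> \<beta>)
      have "smooth_function (cotangent_bundle Q) \<eta>"
        by (rule smooth(3)[OF set_zip_leftD[OF 1(1)]])
      moreover have "smooth_function (cotangent_bundle Q) \<beta>"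
        using determine.hyps(6) set_zip_rightD[OF 1(1)] by blast
      ultimately show ?thesis
        unfolding 1(2) by (rule smooth_function_add_mult[OF A _ _ smooth(2)])
    qed (use smooth in auto)
  qed
next
  case (recombine H \<Theta> \<rho> \<Theta>' \<rho>')
  then show ?case by (auto simp: equivalent_constraints_def smooth_combination_def)
qed auto

lemma dirac_bergmann_smooth:
  assumes "differentiable_atlas (cotangent_bundle Q)" "dirac_bergmann Q L N H \<Theta> \<phi>"
  shows "smooth_function (cotangent_bundle Q) H" "smooth_function (cotangent_bundle Q) (\<phi> i)"
proof -
  obtain \<rho> ks where stage: "dirac_stage Q L N H \<Theta> \<rho>" and ks: "set ks = UNIV"
    "map \<phi> ks = filter (first_class Q (\<Theta> @ \<rho>)) (\<Theta> @ \<rho>)"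
    using assms(2) unfolding dirac_bergmann_def by blast
  \<comment> \<open>Since \<open>ks\<close> exhausts the index type, each \<phi> occurs in the
    filtered list and hence among the constraints of the final stage.\<close>
  have "\<phi> i \<in> set (map \<phi> ks)" using ks(1) by auto
  then have "\<phi> i \<in> set (\<Theta> @ \<rho>)" unfolding ks(2) by auto
  then show "smooth_function (cotangent_bundle Q) H" "smooth_function (cotangent_bundle Q) (\<phi> i)"
    using dirac_stage_smooth[OF assms(1) stage] by auto
qed

lemma partial_affine:
  fixes g :: "'k::finite \<Rightarrow> real"
  shows "partial i (\<lambda>m. a + (\<Sum>k\<in>UNIV. m $ k * g k)) l = g i"
proof -
  have "((\<lambda>m. a + (\<Sum>k\<in>UNIV. m $ k * g k)) has_derivative (\<lambda>d. \<Sum>k\<in>UNIV. d $ k * g k)) (at l)"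
    by (auto intro!: derivative_eq_intros bounded_linear_imp_has_derivative)
  then show ?thesis
    by (simp add: partial_def frechet_derivative_eqI axis_def if_distrib[of "\<lambda>r. r * _"] cong: if_cong)
qed

lemma sum_UNIV_sum:
  fixes g :: "'a::finite + 'b::finite \<Rightarrow> 'c::comm_monoid_add"
  shows "(\<Sum>s\<in>UNIV. g s) = (\<Sum>i\<in>UNIV. g (Inl i)) + (\<Sum>j\<in>UNIV. g (Inr j))"
  by (simp add: sum.Plus UNIV_Plus_UNIV[symmetric] del: UNIV_Plus_UNIV)

text \<open>Full row rank means surjectivity, and a preimage under \<open>M\<close> padded with
  zeros is a preimage under the larger matrix.\<close>

lemma rank_append_zero_columns:
  fixes M :: "real ^ 'n::finite ^ 'k::finite"
  assumes "rank M = CARD('k)"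
  shows "rank ((\<chi> i s. case s of Inl j \<Rightarrow> M $ i $ j | Inr j \<Rightarrow> 0) :: real ^ ('n + 'm::finite) ^ 'k) = CARD('k)"
    (is "rank ?A = _")
proof -
  have "surj ((*v) ?A)"
  proof (rule surjI)
    fix y
    have "surj ((*v) M)" using assms by (simp add: full_rank_surjective)
    then have v: "M *v inv ((*v) M) y = y" by (rule surj_f_inv_f)
    have "?A *v (\<chi> s. case s of Inl j \<Rightarrow> v $ j | Inr _ \<Rightarrow> 0) = M *v v" for v
      by (simp add: matrix_vector_mult_def vec_eq_iff sum_UNIV_sum)
    with v show "?A *v ((\<lambda>y. \<chi> s. case s of Inl j \<Rightarrow> inv ((*v) M) y $ j | Inr _ \<Rightarrow> 0) y) = y"
      by simp
  qed
  then show ?thesis by (simp add: full_rank_surjective)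
qed

section \<open>The total Hamiltonian over an arbitrary atlas\<close>

context
  fixes A :: "('x, 'n::finite) chart set" and H :: "'x \<Rightarrow> real" and \<phi> :: "'k::finite \<Rightarrow> 'x \<Rightarrow> real"
  assumes A: "differentiable_atlas A"
    and H: "smooth_function A H" and \<phi>: "\<And>i. smooth_function A (\<phi> i)"
begin

lemma total_hamiltonian_eq: "total_hamiltonian H \<phi> (x, l) = H x + (\<Sum>i\<in>UNIV. l $ i * \<phi> i x)"
  by (simp add: total_hamiltonian_def)

lemma partial_total_hamiltonian: "partial i (\<lambda>m. total_hamiltonian H \<phi> (x, m)) l = \<phi> i x"
  by (simp add: total_hamiltonian_eq partial_affine)

lemma critical_set_total_hamiltonian:
  "critical_set A (total_hamiltonian H \<phi>) = {(x, l). x \<in> points A \<and> (\<forall>i. \<phi> i x = 0)}"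
  by (simp add: critical_set_def partial_total_hamiltonian)

lemma differentiable_in_chart:
  "smooth_function A f \<Longrightarrow> c \<in> charts_at A x \<Longrightarrow> (f \<circ> chart_inv c) differentiable (at (snd c x))"
  by (rule smooth_on_differentiable[OF smooth_functionD]) (auto simp: charts_at_iff)

lemma gradient_total_hamiltonian:
  assumes "c \<in> charts_at A x"
  shows "gradient (\<lambda>y. total_hamiltonian H \<phi> (chart_inv c y, l)) (snd c x) =
    gradient (H \<circ> chart_inv c) (snd c x) + (\<Sum>i\<in>UNIV. l $ i *\<^sub>R gradient (\<phi> i \<circ> chart_inv c) (snd c x))"
  using gradient_linear_family[OF differentiable_in_chart[OF H assms]
      differentiable_in_chart[OF \<phi> assms], of l]
  by (simp add: total_hamiltonian_eq)

lemma smooth_function_total_hamiltonian: "smooth_function A (\<lambda>x. total_hamiltonian H \<phi> (x, l))"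
  unfolding smooth_function_def o_def total_hamiltonian_eq
  by (intro ballI smooth_on_add smooth_on_sum smooth_on_mult smooth_on_const open_chart_image[OF A])
    (use H \<phi> in \<open>simp_all add: smooth_function_def o_def\<close>)

lemma morse_family_total_hamiltonian:
  assumes reg: "zero_regular_value A \<phi>"
  shows "morse_family A (total_hamiltonian H \<phi>)"
  unfolding morse_family_def
proof (intro conjI ballI, goal_cases)
  case (1 c)
  have U: "open (chart_image c)" by (rule open_chart_image[OF A 1])
  then have UU: "open (chart_image c \<times> (UNIV :: (real ^ 'k) set))" by (simp add: open_Times)
  \<comment> \<open>Joint smoothness in position and multipliers comes from composing with the
    linear projection \<open>fst\<close>; the multipliers themselves are linear coordinates.\<close>
  have f: "smooth_on (chart_image c \<times> (UNIV :: (real ^ 'k) set)) (\<lambda>z. f (chart_inv c (fst z)))"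
    if "smooth_function A f" for f
    using smooth_on_compose_linear[OF bounded_linear_fst U UU _ smooth_functionD[OF that 1]]
    by (auto simp: o_def)
  have l: "smooth_on (chart_image c \<times> UNIV) (\<lambda>z. snd z $ i :: real)" for i :: 'k
    by (rule smooth_on_bounded_linear[OF bounded_linear_compose[OF bounded_linear_vec_nth bounded_linear_snd] UU])
  show ?case
    unfolding case_prod_unfold total_hamiltonian_eq
    by (intro smooth_on_add smooth_on_sum smooth_on_mult UU f l H \<phi>)
next
  case (2 z)
  then obtain x l where z: "z = (x, l)" "x \<in> points A" "\<And>i. \<phi> i x = 0"
    by (auto simp: critical_set_total_hamiltonian)
  have "rank (morse_matrix c (total_hamiltonian H \<phi>) x l) = CARD('k)" if c: "c \<in> charts_at A x" for c
  proof -
    let ?M = "(\<chi> i. gradient (\<phi> i \<circ> chart_inv c) (snd c x)) :: real ^ 'n ^ 'k"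
    have "partial j (\<lambda>y. total_hamiltonian H \<phi> (chart_inv c y, m)) (snd c x) =
        gradient (H \<circ> chart_inv c) (snd c x) $ j +
        (\<Sum>k\<in>UNIV. m $ k * gradient (\<phi> k \<circ> chart_inv c) (snd c x) $ j)" for j m
      using arg_cong[OF gradient_total_hamiltonian[OF c, of m], of "\<lambda>v. v $ j"]
      by (simp add: gradient_def)
    moreover have "partial j (\<lambda>m. total_hamiltonian H \<phi> (x, m)) = (\<lambda>_. \<phi> j x)" for j
      by (rule ext) (rule partial_total_hamiltonian)
    moreover have "partial i (\<lambda>_. a) l = 0" for i a
      by (simp add: partial_def)
    ultimately have e: "morse_matrix c (total_hamiltonian H \<phi>) x l =
        (\<chi> i s. case s of Inl j \<Rightarrow> ?M $ i $ j | Inr j \<Rightarrow> 0)"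
      by (simp add: morse_matrix_def partial_affine vec_eq_iff split: sum.split)
    have "rank ?M = CARD('k)"
      using reg c z(2,3) unfolding zero_regular_value_def by blast
    then show ?thesis
      unfolding e by (rule rank_append_zero_columns)
  qed
  then show ?case using z by auto
qed

text \<open>The left-hand side imposes the gradient equation in all charts around the point, the
  right-hand side in one. Passing from one to all is possible because a covector exists with the
  given component and transforms like the gradient.\<close>

lemma generated_submanifold_in_chart:
  assumes c: "c \<in> A"
  shows "snd (cotangent_chart A c) `
      (generated_submanifold A (total_hamiltonian H \<phi>) \<inter> fst (cotangent_chart A c)) =
    {join x e | x e. x \<in> chart_image c \<and> (\<forall>i. (\<phi> i \<circ> chart_inv c) x = 0) \<and>
      (\<exists>l. e = gradient (H \<circ> chart_inv c) x
        + (\<Sum>i\<in>UNIV. l $ i *\<^sub>R gradient (\<phi> i \<circ> chart_inv c) x))}" (is "?L = ?R")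
proof
  show "?L \<subseteq> ?R"
  proof
    fix z assume "z \<in> ?L"
    then obtain q p l where q: "q \<in> fst c" "z = join (snd c q) (p c)" "\<And>i. \<phi> i q = 0"
      and p: "\<forall>c\<in>charts_at A q. p c = gradient (\<lambda>y. total_hamiltonian H \<phi> (chart_inv c y, l)) (snd c q)"
      by (auto simp: generated_submanifold_def cotangent_chart_def critical_set_total_hamiltonian)
    have "c \<in> charts_at A q" using c q by (simp add: charts_at_iff)
    then show "z \<in> ?R"
      using p q gradient_total_hamiltonian[of c q l] chart_inv_apply[OF A c q(1)] by auto
  qed
  show "?R \<subseteq> ?L"
  proof
    fix z assume "z \<in> ?R"
    then obtain q l where q: "q \<in> fst c" "\<And>i. \<phi> i q = 0" and z: "z = join (snd c q)
        (gradient (H \<circ> chart_inv c) (snd c q)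
        + (\<Sum>i\<in>UNIV. l $ i *\<^sub>R gradient (\<phi> i \<circ> chart_inv c) (snd c q)))"
      using chart_inv_apply[OF A c] by auto
    have at: "c \<in> charts_at A q" using c q by (simp add: charts_at_iff)
    \<comment> \<open>Freezing \<open>l\<close> gives a single function on the manifold, to which
      the chart-change law for gradients applies.\<close>
    define K where "K = (\<lambda>x. total_hamiltonian H \<phi> (x, l))"
    have K: "smooth_function A K" unfolding K_def by (rule smooth_function_total_hamiltonian)
    obtain p where p: "p \<in> cotangent_space A q" "p c = gradient (K \<circ> chart_inv c) (snd c q)"
      using covector_exists[OF A at] by blast
    have "p c' = gradient (K \<circ> chart_inv c') (snd c' q)" if "c' \<in> charts_at A q" for c'
      by (rule gradient_covectorI[OF A p(1) at that differentiable_in_chart[OF K at] p(2)])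
    then have "(q, p) \<in> generated_submanifold A (total_hamiltonian H \<phi>)"
      using p(1) q points_charts_at[OF at]
      by (auto simp: generated_submanifold_def critical_set_total_hamiltonian K_def o_def)
    moreover have "(q, p) \<in> fst (cotangent_chart A c)"
      using p(1) q by (simp add: cotangent_chart_def)
    moreover have "z = snd (cotangent_chart A c) (q, p)"
      using p(2) z gradient_total_hamiltonian[OF at, of l] by (simp add: cotangent_chart_def K_def o_def)
    ultimately show "z \<in> ?L" by blast
  qed
qed

text \<open>In the canonical chart over \<open>c\<close> the set is the one of
  \<open>local_lagrangian\<close> with the chart image of \<open>c\<close> as \<open>U\<close>. The
  neighbourhood found there contains the whole fibre over the base point, hence also the coordinates
  of \<xi>.\<close>

lemma lagrangian_submanifold_total_hamiltonian:
  assumes reg: "zero_regular_value A \<phi>"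
  shows "lagrangian_submanifold A (generated_submanifold A (total_hamiltonian H \<phi>))"
  unfolding lagrangian_submanifold_def
proof (intro conjI ballI)
  let ?S = "generated_submanifold A (total_hamiltonian H \<phi>)"
  show "?S \<subseteq> points (cotangent_bundle A)"
    by (auto simp: generated_submanifold_def critical_set_total_hamiltonian points_def
        cotangent_bundle_def cotangent_chart_def)
  fix \<xi> C assume \<xi>: "\<xi> \<in> ?S" and "C \<in> charts_at (cotangent_bundle A) \<xi>"
  then obtain c where c: "c \<in> A" "C = cotangent_chart A c" "\<xi> \<in> fst C"
    by (auto simp: charts_at_iff cotangent_bundle_def)
  obtain q p where q: "\<xi> = (q, p)" "q \<in> fst c" "\<And>i. \<phi> i q = 0"
    using \<xi> c by (auto simp: generated_submanifold_def critical_set_total_hamiltonian cotangent_chart_def)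
  have at: "c \<in> charts_at A q" using c q by (simp add: charts_at_iff)
  have "rank ((\<chi> i. gradient (\<phi> i \<circ> chart_inv c) (snd c q)) :: real ^ 'n ^ 'k) = CARD('k)"
    using reg at points_charts_at[OF at] q(3) unfolding zero_regular_value_def by blast
  moreover have "snd c q \<in> chart_image c" using q(2) by blast
  ultimately have local: "\<exists>V (F :: real ^ ('n + 'n) \<Rightarrow> real ^ 'n).
    open V \<and> V \<subseteq> {join x e | x e. x \<in> chart_image c} \<and> (\<forall>e. join (snd c q) e \<in> V) \<and> smooth_on V F \<and>
    {z \<in> V. F z = 0} = snd C ` (?S \<inter> fst C) \<inter> V \<and>
    (\<forall>z\<in>V. F z = 0 \<longrightarrow> surj (frechet_derivative F (at z)) \<and>
      (\<forall>u w. frechet_derivative F (at z) u = 0 \<longrightarrow> frechet_derivative F (at z) w = 0 \<longrightarrow>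
        canonical_form u w = 0))"
    unfolding c(2) generated_submanifold_in_chart[OF c(1)]
    by (intro local_lagrangian open_chart_image[OF A c(1)] smooth_functionD[OF H c(1)]
        smooth_functionD[OF \<phi> c(1)])
  then obtain V and F :: "real ^ ('n + 'n) \<Rightarrow> real ^ 'n" where VF:
    "open V" "V \<subseteq> {join x e | x e. x \<in> chart_image c}" "\<forall>e. join (snd c q) e \<in> V" "smooth_on V F"
    "{z \<in> V. F z = 0} = snd C ` (?S \<inter> fst C) \<inter> V"
    "\<forall>z\<in>V. F z = 0 \<longrightarrow> surj (frechet_derivative F (at z)) \<and>
      (\<forall>u w. frechet_derivative F (at z) u = 0 \<longrightarrow> frechet_derivative F (at z) w = 0 \<longrightarrow>
        canonical_form u w = 0)"
    by (elim exE conjE) (rule that)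
  have "V \<subseteq> chart_image C"
    using VF(2) by (auto simp: c(2) cotangent_chart_image[OF A c(1)])
  moreover have "snd C \<xi> \<in> V" using VF(3) by (simp add: c(2) q(1) cotangent_chart_def)
  ultimately show "\<exists>V (F :: real ^ ('n + 'n) \<Rightarrow> real ^ 'n).
      open V \<and> V \<subseteq> chart_image C \<and> snd C \<xi> \<in> V \<and> smooth_on V F \<and>
      {z \<in> V. F z = 0} = snd C ` (?S \<inter> fst C) \<inter> V \<and>
      (\<forall>z\<in>V. F z = 0 \<longrightarrow> surj (frechet_derivative F (at z)) \<and>
        (\<forall>u w. frechet_derivative F (at z) u = 0 \<longrightarrow> frechet_derivative F (at z) w = 0 \<longrightarrow>
          canonical_form u w = 0))"
    using VF(1,4-6) by (intro exI[of _ V] exI[of _ F]) simp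
qed

end

theorem mainTheorem1:
  fixes Q :: "('q, 'd::finite) chart set"
    and L :: "('q, 'd) bundle_point \<Rightarrow> real"
    and N :: nat
    and H :: "('q, 'd) bundle_point \<Rightarrow> real"
    and \<Theta> :: "(('q, 'd) bundle_point \<Rightarrow> real) list"
    and \<phi> :: "'k::finite \<Rightarrow> ('q, 'd) bundle_point \<Rightarrow> real"
  assumes "smooth_manifold Q"
    and "smooth_function (tangent_bundle Q) L"
    and "N > 0"
    and "\<forall>c\<in>Q. \<forall>z\<in>fst (tangent_chart Q c). rank (velocity_hessian Q L c z) + N = CARD('d)"
    and "dirac_bergmann Q L N H \<Theta> \<phi>"
    and "\<Theta> \<noteq> []"
    and "zero_regular_value (cotangent_bundle Q) \<phi>"
  shows "critical_set (cotangent_bundle Q) (total_hamiltonian H \<phi>) =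
           {(x, l). x \<in> points (cotangent_bundle Q) \<and> (\<forall>i. \<phi> i x = 0)} \<and>
         morse_family (cotangent_bundle Q) (total_hamiltonian H \<phi>) \<and>
         lagrangian_submanifold (cotangent_bundle Q)
           (generated_submanifold (cotangent_bundle Q) (total_hamiltonian H \<phi>)) \<and>
         (\<forall>c\<in>cotangent_bundle Q. let C = cotangent_chart (cotangent_bundle Q) c in
           snd C ` (generated_submanifold (cotangent_bundle Q) (total_hamiltonian H \<phi>) \<inter> fst C) =
           {join x e | x e. x \<in> chart_image c \<and>
              (\<exists>l. e = gradient (H \<circ> chart_inv c) x
                     + (\<Sum>i\<in>UNIV. l $ i *\<^sub>R gradient (\<phi> i \<circ> chart_inv c) x) \<and>
                 (\<forall>i. partial i (\<lambda>m. total_hamiltonian H \<phi> (chart_inv c x, m)) l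
                        = \<phi> i (chart_inv c x) \<and>
                      \<phi> i (chart_inv c x) = 0))})"
proof -
  \<comment> \<open>The general results are now used with T*Q as base manifold, so the canonical
    charts of T*T*Q are the cotangent charts of those of T*Q.\<close>
  note A = cotangent_bundle_differentiable_atlas[OF assms(1)]
  note smooth = dirac_bergmann_smooth[OF A assms(5)]
  \<comment> \<open>The equation between the \<lambda>-derivative and the constraint holds
    identically, so the displayed condition on \<open>l\<close> reduces to the one in
    \<open>generated_submanifold_in_chart\<close>.\<close>
  have chart: "snd (cotangent_chart (cotangent_bundle Q) c) `
      (generated_submanifold (cotangent_bundle Q) (total_hamiltonian H \<phi>) \<inter>
        fst (cotangent_chart (cotangent_bundle Q) c)) =
      {join x e | x e. x \<in> chart_image c \<and>
        (\<exists>l. e = gradient (H \<circ> chart_inv c) x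
               + (\<Sum>i\<in>UNIV. l $ i *\<^sub>R gradient (\<phi> i \<circ> chart_inv c) x) \<and>
           (\<forall>i. partial i (\<lambda>m. total_hamiltonian H \<phi> (chart_inv c x, m)) l = \<phi> i (chart_inv c x) \<and>
              \<phi> i (chart_inv c x) = 0))}" if "c \<in> cotangent_bundle Q" for c
    unfolding generated_submanifold_in_chart[OF A smooth that] partial_total_hamiltonian[OF A smooth] o_apply
    by blast
  show ?thesis
    unfolding Let_def
    by (intro conjI ballI chart critical_set_total_hamiltonian[OF A smooth]
        morse_family_total_hamiltonian[OF A smooth assms(7)]
        lagrangian_submanifold_total_hamiltonian[OF A smooth assms(7)])
qed

end
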